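(* Let $p$ be a constant and let $q:\mathbb{R}^2\to\mathbb{R}$ be a measurable function with $1<p<q_-\le q_+<\infty$. Let $\alpha,\beta:\mathbb{R}\to\mathbb{R}$ be measurable functions with $0<\alpha_-\le\alpha_+<1$ and $0<\beta_-\le\beta_+<1$. Let $v$ and $w$ be weights on $\mathbb{R}^2$, where $w$ is of product type, i.e. $w(x,y)=w_1(x)w_2(y)$ for one-dimensional weights $w_1,w_2$, and suppose that $w_1^{-p'},w_2^{-p'}\in RD^{(d)}(\mathbb{R})$. Then $M^S_{\alpha(\cdot),\beta(\cdot)}$ is bounded from $L^p_w(\mathbb{R}^2)$ to $L^{q(\cdot)}_v(\mathbb{R}^2)$ if and only if $$\sup_{I,J\subset\mathbb{R}}(|I||J|)^{-1}\big\|v(\cdot)|I|^{\alpha(\cdot)}|J|^{\beta(\cdot)}\big\|_{L^{q(\cdot)}(I\times J)}\,\big\|w^{-1}\big\|_{L^{p'}(I\times J)}<+\infty,$$ where the supremum is over all bounded intervals $I,J$ in $\mathbb{R}$.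
   Context: For a function $g$ on its domain, $g_-$ and $g_+$ denote its infimum and supremum; $p'=p/(p-1)$. A weight is an a.e. positive measurable function. The norm of $L^{q(\cdot)}(E)$ is $\|f\|_{L^{q(\cdot)}(E)}=\inf\{\lambda>0:\int_E|f(x)/\lambda|^{q(x)}dx\le1\}$, and $\|f\|_{L^{q(\cdot)}_v}=\|fv\|_{L^{q(\cdot)}}$, $\|f\|_{L^p_w}=\|fw\|_{L^p}$. Intervals have positive length, and $v(\cdot)|I|^{\alpha(\cdot)}|J|^{\beta(\cdot)}$ denotes $(s,t)\mapsto v(s,t)|I|^{\alpha(s)}|J|^{\beta(t)}$. The strong fractional maximal operator of variable order is $$(M^S_{\alpha(\cdot),\beta(\cdot)}f)(x,y)=\sup_{I\ni x,\ J\ni y}|I|^{\alpha(x)-1}|J|^{\beta(y)-1}\iint_{I\times J}|f(t,\tau)|\,dt\,d\tau,$$ the supremum being over bounded intervals. A weight $\rho$ on $\mathbb{R}$ satisfies the dyadic reverse doubling condition, $\rho\in RD^{(d)}(\mathbb{R})$, if there is a constant $b>1$ such that $b\,\rho(I)\le\rho(I')$ for any two dyadic intervals $I\subset I'$ with $|I|=|I'|/2$, where $\rho(E)=\int_E\rho$ and the dyadic intervals are $[2^kj,2^k(j+1))$, $j,k\in\mathbb{Z}$. Bounded means that there is $c>0$ with $\|M^S_{\alpha(\cdot),\beta(\cdot)}f\|_{L^{q(\cdot)}_v}\le c\|f\|_{L^p_w}$ for all $f\in L^p_w(\mathbb{R}^2)$. *)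

theory Defs
  imports "HOL-Analysis.Analysis"
begin

text \<open>
  All measures are Lebesgue measure on the completed sigma-algebra, and the plane is the type
  \<open>real \<times> real\<close>. Norms and suprema take values in \<open>[0, \<infinity>]\<close> (type \<open>ennreal\<close>).
\<close>

definition is_weight :: "('a::euclidean_space \<Rightarrow> real) \<Rightarrow> bool" where
  "is_weight v \<longleftrightarrow> v \<in> borel_measurable lebesgue \<and> (AE x in lebesgue. 0 < v x)"

definition conj_exponent :: "real \<Rightarrow> real" where
  "conj_exponent p = p / (p - 1)"

text \<open>Real power on \<open>[0, \<infinity>]\<close>, meant for exponents \<open>a > 0\<close> only.\<close>

definition ennreal_pow :: "ennreal \<Rightarrow> real \<Rightarrow> ennreal" where
  "ennreal_pow x a = (if x = top then top else ennreal (enn2real x powr a))"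

text \<open>
  The norms act on functions with values in \<open>[0, \<infinity>]\<close>, since a maximal function may be infinite;
  they are applied to absolute values. An empty infimum is \<open>\<infinity>\<close>.
\<close>

definition lux_norm :: "'a::euclidean_space set \<Rightarrow> ('a \<Rightarrow> real) \<Rightarrow> ('a \<Rightarrow> ennreal) \<Rightarrow> ennreal" where
  "lux_norm E q F =
    (INF l \<in> {l::real. 0 < l \<and> (\<integral>\<^sup>+x\<in>E. ennreal_pow (F x / ennreal l) (q x) \<partial>lebesgue) \<le> 1}.
      ennreal l)"

definition Lp_norm :: "'a::euclidean_space set \<Rightarrow> real \<Rightarrow> ('a \<Rightarrow> ennreal) \<Rightarrow> ennreal" where
  "Lp_norm E p F = ennreal_pow (\<integral>\<^sup>+x\<in>E. ennreal_pow (F x) p \<partial>lebesgue) (1 / p)"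

text \<open>Intervals may be open, closed or half-open.\<close>

definition bounded_intervals :: "real set set" where
  "bounded_intervals = {I. is_interval I \<and> bounded I \<and> 0 < measure lebesgue I}"

definition strong_frac_max ::
    "(real \<Rightarrow> real) \<Rightarrow> (real \<Rightarrow> real) \<Rightarrow> (real \<times> real \<Rightarrow> real) \<Rightarrow> real \<times> real \<Rightarrow> ennreal" where
  "strong_frac_max \<alpha> \<beta> f = (\<lambda>(x, y).
    (SUP I \<in> {I \<in> bounded_intervals. x \<in> I}. SUP J \<in> {J \<in> bounded_intervals. y \<in> J}.
      ennreal (measure lebesgue I powr (\<alpha> x - 1) * measure lebesgue J powr (\<beta> y - 1))
        * (\<integral>\<^sup>+u\<in>I \<times> J. ennreal \<bar>f u\<bar> \<partial>lebesgue)))"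

definition weighted_Lp ::
    "real \<Rightarrow> ('a::euclidean_space \<Rightarrow> real) \<Rightarrow> ('a \<Rightarrow> real) set" where
  "weighted_Lp p w =
    {f \<in> borel_measurable lebesgue. Lp_norm UNIV p (\<lambda>z. ennreal \<bar>f z * w z\<bar>) < \<infinity>}"

definition strong_frac_max_bounded ::
    "real \<Rightarrow> (real \<times> real \<Rightarrow> real) \<Rightarrow> (real \<times> real \<Rightarrow> real) \<Rightarrow> (real \<times> real \<Rightarrow> real)
      \<Rightarrow> (real \<Rightarrow> real) \<Rightarrow> (real \<Rightarrow> real) \<Rightarrow> bool" where
  "strong_frac_max_bounded p w q v \<alpha> \<beta> \<longleftrightarrow>
    (\<exists>c::real. 0 < c \<and> (\<forall>f \<in> weighted_Lp p w.
      lux_norm UNIV q (\<lambda>z. strong_frac_max \<alpha> \<beta> f z * ennreal \<bar>v z\<bar>)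
        \<le> ennreal c * Lp_norm UNIV p (\<lambda>z. ennreal \<bar>f z * w z\<bar>)))"

definition dyadic_intervals :: "real set set" where
  "dyadic_intervals =
    {{2 powi k * of_int j ..< 2 powi k * (of_int j + 1)} | (j::int) (k::int). True}"

definition dyadic_reverse_doubling :: "(real \<Rightarrow> real) \<Rightarrow> bool" where
  "dyadic_reverse_doubling \<rho> \<longleftrightarrow>
    (\<exists>b::real. 1 < b \<and> (\<forall>I \<in> dyadic_intervals. \<forall>I' \<in> dyadic_intervals.
      I \<subseteq> I' \<and> measure lebesgue I = measure lebesgue I' / 2 \<longrightarrow>
        ennreal b * (\<integral>\<^sup>+x\<in>I. ennreal (\<rho> x) \<partial>lebesgue)
          \<le> (\<integral>\<^sup>+x\<in>I'. ennreal (\<rho> x) \<partial>lebesgue)))"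

end

theory Submission
  imports Defs
begin

text \<open>
  Write \<open>p' = conj_exponent p\<close>, \<open>\<sigma> = w powr (- p')\<close> (a product \<open>\<sigma>1 \<otimes> \<sigma>2\<close>), and \<open>\<sigma>(R)\<close> for the
  integral of \<open>\<sigma>\<close> over a rectangle \<open>R = I \<times> J\<close>.

  Necessity is a test with one function: \<open>f = \<sigma>\<close> on \<open>I \<times> J\<close> satisfies \<open>\<bar>f w\<bar> powr p = \<sigma>\<close>, and on \<open>I \<times> J\<close>
  its maximal function is at least \<open>\<bar>I\<bar> powr (\<alpha> - 1) * \<bar>J\<bar> powr (\<beta> - 1) * \<sigma>(I \<times> J)\<close>. Since \<open>\<sigma>\<close> need not
  be integrable a priori, \<open>f\<close> is cut off where \<open>1 / \<bar>w\<bar>\<close> is large (\<open>weighted_test_condition\<close>).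

  For sufficiency, an interval around \<open>x\<close> is covered by three neighbouring dyadic intervals of
  comparable length, so \<open>M f(x, y)\<close> is at most \<open>36\<close> times the supremum of
  \<open>\<bar>I\<bar> powr (\<alpha> x - 1) * \<bar>J\<bar> powr (\<beta> y - 1) * (\<integral>\<^sub>R \<bar>f\<bar>)\<close> over the dyadic rectangles \<open>R = I \<times> J\<close> whose
  triple \<open>3R\<close> contains \<open>(x, y)\<close> (\<open>strong_frac_max_dyadic_bound\<close>). Working with triples of standard dyadic
  intervals instead of shifted grids matters: the reverse doubling condition concerns the standard
  grid only, whereas the assumed supremum runs over all intervals and may be used on \<open>3R\<close>.

  Bound the supremum over \<open>R\<close> by the sum. The modular of \<open>M f \<cdot> v\<close> is then at most the sum over \<open>R\<close> of
  the integrals over \<open>3R\<close> of \<open>(t\<^sub>R \<phi>\<^sub>R) powr q\<close>. Here \<open>\<phi>\<^sub>R\<close> is \<open>v \<bar>I\<bar> powr \<alpha> \<bar>J\<bar> powr \<beta>\<close> divided by a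
  constant for which, by the hypothesis on \<open>3R\<close>, its modular is at most \<open>1\<close>; and \<open>t\<^sub>R\<close> is a constant
  times \<open>\<sigma>(R) powr (- 1 / p') * (\<integral>\<^sub>R \<bar>f\<bar>)\<close>, which is at most \<open>1\<close> by Hoelder's inequality once \<open>f\<close> is
  normalised. Fix \<open>r\<close> with \<open>p < r \<le> q\<close>. Because \<open>t\<^sub>R \<le> 1\<close>, \<open>t\<^sub>R powr q \<le> t\<^sub>R powr r\<close>: the variable exponents
  have disappeared, and it remains to bound the sum over all dyadic rectangles of
  \<open>(\<sigma>(R) powr (- 1 / p') * (\<integral>\<^sub>R \<bar>f\<bar>)) powr r\<close> by a constant times the \<open>r\<close>-th power of the norm of \<open>f w\<close>
  (\<open>strong_dyadic_embedding\<close>; the conclusion is drawn in \<open>strong_frac_max_norm_bound\<close>).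

  This is where \<open>p < r\<close> and reverse doubling enter. In one variable put, for a dyadic interval \<open>I\<close>,
  \<open>G(I) = \<sigma>(I) powr (1 - p) * (\<integral>\<^sub>I \<bar>f\<bar>) powr p\<close> and \<open>F(I) = \<integral>\<^sub>I \<bar>f w\<bar> powr p\<close>, so that \<open>G \<le> F\<close>, and let
  \<open>s = r / p > 1\<close>. For the two halves \<open>I1, I2\<close> of \<open>I\<close> one has, with constants \<open>c, C > 0\<close>,
  \<open>(c + 1) G(I)\<^sup>s + C (F(I1)\<^sup>s + F(I2)\<^sup>s) \<le> C F(I)\<^sup>s + c (G(I1)\<^sup>s + G(I2)\<^sup>s)\<close> (\<open>bellman_step\<close>).
  Either both halves carry an amount of \<open>F\<close> comparable with \<open>G(I)\<close>, and the strict superadditivity of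
  \<open>F\<^sup>s\<close> pays for \<open>G(I)\<^sup>s\<close>; or almost all of the integral of \<open>f\<close> sits on one half, where \<open>\<sigma>\<close> is smaller by
  at least the factor \<open>b\<close>, and \<open>G\<close> is larger there than on \<open>I\<close> by a fixed factor. Summed over the intervals of
  one length, the inequality telescopes in the length and bounds the sum of all \<open>G(I)\<^sup>s\<close>.

  The Bellman inequality uses of \<open>(\<integral>\<^sub>I \<bar>f\<bar>) powr p\<close> only the bound \<open>G \<le> F\<close> and an approximate
  subadditivity, and both survive integration in a further variable. The one-dimensional embedding therefore holds for functions
  with values in \<open>L\<^sup>p\<close>, and applying it first in \<open>x\<close> for each fixed \<open>J\<close>, then in \<open>y\<close> to the
  vector-valued function, gives the embedding for rectangles (\<open>dyadic_embedding_vector\<close>).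
\<close>

section \<open>Powers of extended nonnegative numbers\<close>

lemma ennreal_pow_ennreal: "0 \<le> x \<Longrightarrow> ennreal_pow (ennreal x) a = ennreal (x powr a)"
  by (simp add: ennreal_pow_def)

lemma ennreal_pow_top [simp]: "ennreal_pow top a = top"
  by (simp add: ennreal_pow_def)

lemma ennreal_pow_0 [simp]: "ennreal_pow 0 a = 0"
  by (simp add: ennreal_pow_def)

lemma ennreal_pow_eq_top_iff [simp]: "ennreal_pow x a = top \<longleftrightarrow> x = top"
  by (simp add: ennreal_pow_def)

lemma ennreal_pow_eq_0_iff [simp]: "ennreal_pow x a = 0 \<longleftrightarrow> x = 0"
  by (cases x) (auto simp: ennreal_pow_ennreal)

lemma ennreal_pow_1 [simp]: "ennreal_pow x 1 = x"
  by (cases x) (auto simp: ennreal_pow_ennreal)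

lemma ennreal_pow_mono: "0 \<le> a \<Longrightarrow> x \<le> y \<Longrightarrow> ennreal_pow x a \<le> ennreal_pow y a"
  by (cases x; cases y) (auto simp: ennreal_pow_ennreal powr_mono2 top_unique)

lemma ennreal_pow_mult: "ennreal_pow (x * y) a = ennreal_pow x a * ennreal_pow y a"
proof (cases x; cases y)
  fix r s assume "x = ennreal r" "0 \<le> r" "y = ennreal s" "0 \<le> s"
  then show ?thesis
    by (simp add: ennreal_pow_ennreal ennreal_mult[symmetric] powr_mult)
qed (auto simp: ennreal_mult_top ennreal_top_mult ennreal_pow_ennreal)

lemma ennreal_pow_pow: "ennreal_pow (ennreal_pow x a) b = ennreal_pow x (a * b)"
  by (cases x) (auto simp: ennreal_pow_ennreal powr_powr)

lemma borel_measurable_ennreal_pow [measurable (raw)]: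
  assumes [measurable]: "f \<in> borel_measurable M" "a \<in> borel_measurable M"
  shows "(\<lambda>x. ennreal_pow (f x) (a x)) \<in> borel_measurable M"
  unfolding ennreal_pow_def by measurable

text \<open>
  The map \<open>x \<mapsto> x powr a\<close> is an order isomorphism of \<open>[0, \<infinity>]\<close>, which allows roots to be moved across
  inequalities between possibly infinite quantities.
\<close>

lemma ennreal_pow_inverse_le_iff:
  assumes "0 < a"
  shows "ennreal_pow x a \<le> y \<longleftrightarrow> x \<le> ennreal_pow y (1 / a)"
  using assms ennreal_pow_mono[of a x "ennreal_pow y (1 / a)"]
    ennreal_pow_mono[of "1/a" "ennreal_pow x a" y]
  by (auto simp: ennreal_pow_pow)

text \<open>
  This is what replaces the variable exponent by a constant one.
\<close>

lemma ennreal_pow_antimono_exponent: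
  assumes "x \<le> 1" "a \<le> b"
  shows "ennreal_pow x b \<le> ennreal_pow x a"
  using assms by (cases x) (auto simp: ennreal_pow_ennreal intro!: ennreal_leI powr_mono')

text \<open>
  A substitute for Minkowski's inequality that can be integrated term by term: compare \<open>y\<close> with
  \<open>d * x\<close>. The point is that the factor in front of one of the terms may be taken arbitrarily close to \<open>1\<close>.
\<close>

lemma ennreal_pow_add_le:
  assumes "0 \<le> p" "0 < d"
  shows "ennreal_pow (x + y) p \<le> ennreal ((1 + d) powr p) * ennreal_pow x p + ennreal ((1 + 1 / d) powr p) * ennreal_pow y p"
proof (cases "y \<le> ennreal d * x")
  case True
  then have "x + y \<le> ennreal (1 + d) * x"
    using assms by (simp add: distrib_right add_left_mono)
  then have "ennreal_pow (x + y) p \<le> ennreal_pow (ennreal (1 + d) * x) p"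
    using assms by (intro ennreal_pow_mono)
  also have "\<dots> = ennreal ((1 + d) powr p) * ennreal_pow x p"
    using assms by (simp add: ennreal_pow_mult ennreal_pow_ennreal del: ennreal_plus)
  finally show ?thesis by (simp add: add_increasing2)
next
  case False
  then have "ennreal (1 / d) * (ennreal d * x) \<le> ennreal (1 / d) * y" by (intro mult_left_mono) auto
  then have "x \<le> ennreal (1 / d) * y"
    using assms by (simp add: mult.assoc[symmetric] ennreal_mult[symmetric])
  then have "x + y \<le> ennreal (1 + 1 / d) * y"
    using assms by (simp add: distrib_right add_right_mono add.commute)
  then have "ennreal_pow (x + y) p \<le> ennreal_pow (ennreal (1 + 1 / d) * y) p"
    using assms by (intro ennreal_pow_mono)
  also have "\<dots> = ennreal ((1 + 1 / d) powr p) * ennreal_pow y p"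
    using assms by (simp add: ennreal_pow_mult ennreal_pow_ennreal del: ennreal_plus)
  finally show ?thesis by (simp add: add_increasing)
qed

section \<open>Hoelder's inequality\<close>

text \<open>
  Convexity of \<open>exp\<close> at \<open>p * ln a\<close> and \<open>p' * ln b\<close> with weights \<open>1 / p\<close> and \<open>1 / p'\<close>.
\<close>

lemma Young_powr:
  fixes a b p :: real
  assumes "1 < p" "0 \<le> a" "0 < b"
  shows "a * b \<le> a powr p / p + b powr (conj_exponent p) / conj_exponent p"
proof (cases "a = 0")
  case True
  then show ?thesis using assms by (auto simp: conj_exponent_def)
next
  case False
  then have a: "0 < a" using assms by auto
  define \<theta> where "\<theta> = 1 / p"
  have \<theta>: "0 \<le> \<theta>" "\<theta> \<le> 1" "1 - \<theta> = 1 / conj_exponent p"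
    using assms by (auto simp: \<theta>_def conj_exponent_def field_simps)
  have ce: "conj_exponent p > 0" using assms by (auto simp: conj_exponent_def)
  have "exp (\<theta> * (p * ln a) + (1-\<theta>) * (conj_exponent p * ln b)) \<le> \<theta> * exp (p * ln a) + (1-\<theta>) * exp (conj_exponent p * ln b)"
    using convex_onD[OF exp_convex, of "1 - \<theta>" "p * ln a" "conj_exponent p * ln b"] \<theta>(1,2)
    by simp
  moreover have "\<theta> * (p * ln a) + (1-\<theta>) * (conj_exponent p * ln b) = ln a + ln b"
    unfolding \<theta>(3) using ce assms by (simp add: \<theta>_def)
  ultimately show ?thesis using a assms \<theta>(3) ce by (simp add: exp_add powr_def \<theta>_def)
qed

text \<open>
  Young's inequality for \<open>t * H\<close> and \<open>1 / (t * u)\<close>, integrated, with \<open>t\<close> chosen so that both terms on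
  the right are equal. Raising to the power \<open>p\<close> keeps the right-hand side linear in the integral of
  \<open>H powr p\<close>, as needed for sums over dyadic intervals.
\<close>

lemma Hoelder_weighted:
  fixes u :: "'a \<Rightarrow> real" and H :: "'a \<Rightarrow> ennreal"
  assumes p: "1 < p" and [measurable]: "H \<in> borel_measurable M" "u \<in> borel_measurable M"
    and u: "\<And>x. 0 < u x"
    and fin: "(\<integral>\<^sup>+x. ennreal (u x powr (- conj_exponent p)) \<partial>M) < \<infinity>"
  shows "ennreal_pow (\<integral>\<^sup>+x. H x * ennreal (1 / u x) \<partial>M) p
    \<le> (\<integral>\<^sup>+x. ennreal_pow (H x) p \<partial>M)
        * ennreal_pow (\<integral>\<^sup>+x. ennreal (u x powr (- conj_exponent p)) \<partial>M) (p - 1)"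
proof -
  let ?q = "conj_exponent p"
  let ?S = "\<integral>\<^sup>+x. ennreal (u x powr (- ?q)) \<partial>M" and ?P = "\<integral>\<^sup>+x. ennreal_pow (H x) p \<partial>M"
  have q: "?q > 0" "?q = p / (p - 1)" using p by (auto simp: conj_exponent_def)
  show ?thesis
  proof (cases "?S = 0")
    case True
    then have "AE x in M. ennreal (u x powr (- ?q)) = 0"
      by (subst (asm) nn_integral_0_iff_AE) auto
    then have "AE x in M. H x * ennreal (1 / u x) = 0"
    proof eventually_elim
      case (elim x)
      then show ?case using u[of x] by (simp add: ennreal_eq_0_iff)
    qed
    then have "(\<integral>\<^sup>+x. H x * ennreal (1 / u x) \<partial>M) = 0"
      by (subst nn_integral_0_iff_AE) auto
    then show ?thesis by simp
  next
    case S0: False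
    show ?thesis
    proof (cases "?P = 0 \<or> ?P = top")
      case True
      show ?thesis
      proof (cases "?P = 0")
        case True
        then have "AE x in M. ennreal_pow (H x) p = 0"
          by (subst (asm) nn_integral_0_iff_AE) auto
        then have "AE x in M. H x * ennreal (1 / u x) = 0"
          by eventually_elim auto
        then have "(\<integral>\<^sup>+x. H x * ennreal (1 / u x) \<partial>M) = 0"
          by (subst nn_integral_0_iff_AE) auto
        then show ?thesis by simp
      next
        case False
        then show ?thesis using \<open>?P = 0 \<or> ?P = top\<close> S0 by (auto simp: ennreal_top_mult)
      qed
    next
      case False
      define P where "P = enn2real ?P"
      define S where "S = enn2real ?S"
      have P: "?P = ennreal P" "0 < P" using False
        by (auto simp: P_def less_top enn2real_positive_iff zero_less_iff_neq_zero)
      have S: "?S = ennreal S" "0 < S" using S0 fin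
        by (auto simp: S_def less_top enn2real_positive_iff zero_less_iff_neq_zero)
      \<comment> \<open>the scaling for which \<open>t powr p * P = t powr (- p') * S\<close>\<close>
      define t where "t = (S / P) powr (1 / (p * ?q))"
      have t: "0 < t" using P S by (auto simp: t_def)
      have pw: "H x * ennreal (1 / u x) \<le> ennreal (t powr p / p) * ennreal_pow (H x) p
            + ennreal (t powr (- ?q) / ?q) * ennreal (u x powr (- ?q))" for x
      proof (cases "H x")
        case (real h)
        have "h / u x = (h * t) * (1 / (u x * t))" using t by (auto simp: field_simps)
        also have "\<dots> \<le> (h * t) powr p / p + (1 / (u x * t)) powr ?q / ?q"
          by (rule Young_powr) (use p real t u[of x] in auto)
        also have "\<dots> = t powr p / p * h powr p + t powr (- ?q) / ?q * u x powr (- ?q)"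
          using u[of x] t real by (simp add: powr_mult powr_divide powr_minus field_simps)
        finally have "ennreal (h / u x) \<le> ennreal (t powr p / p * h powr p + t powr (- ?q) / ?q * u x powr (- ?q))"
          by (rule ennreal_leI)
        then show ?thesis
          using real p q u[of x] by (simp add: ennreal_pow_ennreal ennreal_mult[symmetric] ennreal_plus[symmetric] divide_inverse less_imp_le del: ennreal_plus)
      next
        case top
        moreover have "\<not> t powr p / p \<le> 0" using p t by (simp add: not_le)
        ultimately show ?thesis by (simp add: ennreal_mult_top ennreal_eq_0_iff)
      qed
      have tp: "t powr p * P = S powr (1 / ?q) * P powr (1 / p)"
      proof -
        have "t powr p = (S / P) powr (1 / ?q)"
          using p q P S by (simp add: t_def powr_powr)
        also have "\<dots> * P = S powr (1 / ?q) * (P powr (- 1 / ?q) * P powr 1)"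
          using P S by (simp add: powr_divide powr_minus field_simps)
        also have "P powr (- 1 / ?q) * P powr 1 = P powr (1 / p)"
          using p by (subst powr_add[symmetric]) (simp add: conj_exponent_def field_simps)
        finally show ?thesis .
      qed
      have tq: "t powr (- ?q) * S = S powr (1 / ?q) * P powr (1 / p)"
      proof -
        have "t powr (- ?q) = (S / P) powr (- 1 / p)"
          using p q P S by (simp add: t_def powr_powr)
        also have "\<dots> * S = P powr (1 / p) * (S powr (- 1 / p) * S powr 1)"
          using P S by (simp add: powr_divide powr_minus field_simps)
        also have "S powr (- 1 / p) * S powr 1 = S powr (1 / ?q)"
          using p by (subst powr_add[symmetric]) (simp add: conj_exponent_def field_simps)
        finally show ?thesis by (simp add: mult.commute)
      qed
      have "(\<integral>\<^sup>+x. H x * ennreal (1 / u x) \<partial>M) \<le> (\<integral>\<^sup>+x. ennreal (t powr p / p) * ennreal_pow (H x) p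
            + ennreal (t powr (- ?q) / ?q) * ennreal (u x powr (- ?q)) \<partial>M)"
        by (intro nn_integral_mono pw)
      also have "\<dots> = ennreal (t powr p / p) * ?P + ennreal (t powr (- ?q) / ?q) * ?S"
        by (subst nn_integral_add) (auto simp: nn_integral_cmult)
      also have "\<dots> = ennreal (t powr p * P / p + t powr (- ?q) * S / ?q)"
        unfolding P S using P S p q by (simp add: ennreal_mult[symmetric] ennreal_plus[symmetric] del: ennreal_plus)
      also have "t powr p * P / p + t powr (- ?q) * S / ?q = S powr (1 / ?q) * P powr (1 / p)"
        unfolding tp tq using p by (simp add: conj_exponent_def field_simps)
      finally have "ennreal_pow (\<integral>\<^sup>+x. H x * ennreal (1 / u x) \<partial>M) p \<le> ennreal_pow (ennreal (S powr (1 / ?q) * P powr (1 / p))) p"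
        using p by (intro ennreal_pow_mono) auto
      also have "\<dots> = ennreal (P * S powr (p - 1))"
        using p P S by (simp add: ennreal_pow_ennreal powr_mult powr_powr conj_exponent_def mult.commute)
      finally show ?thesis
        unfolding P S using P S by (simp add: ennreal_pow_ennreal ennreal_mult)
    qed
  qed
qed

lemma Hoelder_on_set:
  fixes u :: "'a \<Rightarrow> real" and H :: "'a \<Rightarrow> ennreal"
  assumes p: "1 < p" and [measurable]: "H \<in> borel_measurable M" "u \<in> borel_measurable M" "A \<in> sets M"
    and u: "\<And>x. 0 < u x" and fin: "(\<integral>\<^sup>+x\<in>A. ennreal (u x powr (- conj_exponent p)) \<partial>M) < \<infinity>"
  shows "ennreal_pow (\<integral>\<^sup>+y\<in>A. H y * ennreal (1 / u y) \<partial>M) p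
    \<le> (\<integral>\<^sup>+y\<in>A. ennreal_pow (H y) p \<partial>M)
        * ennreal_pow (\<integral>\<^sup>+x\<in>A. ennreal (u x powr (- conj_exponent p)) \<partial>M) (p - 1)"
  using Hoelder_weighted[OF p, of H "restrict_space M A" u] u fin
  by (simp add: nn_integral_restrict_space measurable_restrict_space1)

section \<open>The Bellman inequality for an interval and its halves\<close>

text \<open>
  From \<open>(x + y)\<^sup>s = (x + y) (x + y)\<^sup>s\<^sup>-\<^sup>1\<close>: replacing the last factor by \<open>y\<^sup>s\<^sup>-\<^sup>1\<close> in the term with \<open>y\<close>
  loses a definite proportion, since \<open>y\<close> is at most half of \<open>x + y\<close>.
\<close>

lemma powr_superadditive_gain:
  fixes x y s :: real
  assumes "1 < s" "0 \<le> y" "y \<le> x"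
  shows "x powr s + y powr s + (1 - 2 powr (1 - s)) * (y * (x + y) powr (s - 1)) \<le> (x + y) powr s"
proof -
  have split: "z powr s = z * z powr (s - 1)" if "0 \<le> z" for z :: real
    using powr_mult_base[OF that, of "s - 1"] by simp
  have "x * x powr (s - 1) \<le> x * (x + y) powr (s - 1)"
    using assms by (intro mult_left_mono powr_mono2) auto
  moreover have "y powr (s - 1) \<le> ((x + y) * (1 / 2)) powr (s - 1)"
    using assms by (intro powr_mono2) auto
  then have "y powr (s - 1) \<le> 2 powr (1 - s) * (x + y) powr (s - 1)"
    using assms by (simp add: powr_mult powr_divide powr_diff field_simps)
  then have "y * y powr (s - 1) \<le> y * (2 powr (1 - s) * (x + y) powr (s - 1))"
    using assms by (intro mult_left_mono) auto
  ultimately show ?thesis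
    unfolding split[of x, OF order_trans[OF assms(2,3)]] split[OF assms(2)]
      split[of "x + y", OF add_nonneg_nonneg[OF order_trans[OF assms(2,3)] assms(2)]]
    by (simp add: algebra_simps)
qed

text \<open>
  Here the first half carries the larger share of \<open>F\<close>. In the quantity \<open>n \<sigma> powr (1 - p)\<close>, \<open>n\<close> stands
  for the \<open>p\<close>-th power of the size of an integral over an interval. Either \<open>n \<sigma> powr (1 - p) \<le> K * F2\<close>,
  and the gain in \<open>F powr s\<close> suffices, or the contribution of \<open>n2\<close> to \<open>n\<close> is a small fraction of \<open>n\<close>, and
  passing from \<open>\<sigma>\<close> to \<open>\<sigma>1 \<le> \<sigma> / b\<close> makes \<open>n1 \<sigma>1 powr (1 - p)\<close> exceed \<open>n \<sigma> powr (1 - p)\<close> by the factor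
  \<open>1 + e\<close>.
\<close>

lemma bellman_one_sided:
  fixes p s b :: real
  assumes p: "1 < p" and s: "1 < s" and b: "1 < b"
  obtains c C where "0 < c" "0 < C"
    "\<And>\<sigma> \<sigma>1 \<sigma>2 F1 F2 n n1 n2.
      \<lbrakk>0 < \<sigma>1; 0 < \<sigma>2; b * \<sigma>1 \<le> \<sigma>; \<sigma>2 \<le> \<sigma>; 0 \<le> F2; F2 \<le> F1; 0 \<le> n; 0 \<le> n1; 0 \<le> n2;
        n \<le> (F1 + F2) * \<sigma> powr (p - 1); n2 \<le> F2 * \<sigma>2 powr (p - 1);
        \<And>d. 0 < d \<Longrightarrow> n \<le> (1 + d) powr p * n1 + (1 + 1 / d) powr p * n2\<rbrakk> \<Longrightarrow>
      (c + 1) * (n * \<sigma> powr (1 - p)) powr s + C * F1 powr s + C * F2 powr s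
        \<le> C * (F1 + F2) powr s + c * (n1 * \<sigma>1 powr (1 - p)) powr s + c * (n2 * \<sigma>2 powr (1 - p)) powr s"
proof -
  define B where "B = b powr (p - 1)"
  have B: "1 < B" using b p by (simp add: B_def gr_one_powr)
  \<comment> \<open>small enough that the gain \<open>B\<close> beats two losses of order \<open>1 + e\<close>, see \<open>eB\<close>\<close>
  define e where "e = (B - 1) / (4 * B)"
  have e: "0 < e" "e \<le> 1 / 4" "4 * e * B = B - 1" using B by (auto simp: e_def field_simps)
  have eB: "(1 + e) * (1 + e) \<le> (1 - e) * B"
  proof -
    have "e * 1 \<le> e * B" using e B by (intro mult_left_mono) auto
    moreover have "e * e \<le> e * (1 / 4)" using e by (intro mult_left_mono) auto
    moreover have "(1 + e) * (1 + e) = 1 + 2 * e + e * e" "(1 - e) * B = B - e * B"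
      by (simp_all add: algebra_simps)
    ultimately show ?thesis using e by linarith
  qed
  \<comment> \<open>the parameter of the approximate triangle inequality for which its leading factor is \<open>1 + e\<close>\<close>
  define d where "d = (1 + e) powr (1 / p) - 1"
  have d: "0 < d" using e p by (simp add: d_def gr_one_powr)
  have dp: "(1 + d) powr p = 1 + e" using e p by (simp add: d_def powr_powr)
  define M where "M = (1 + 1 / d) powr p"
  have "0 < 1 + 1 / d" using d by (simp add: add_pos_pos)
  then have M: "0 < M" by (simp add: M_def)
  \<comment> \<open>beyond the ratio \<open>K\<close> the term \<open>M * n2\<close> is absorbed by \<open>e * n\<close>\<close>
  define K where "K = M / e"
  have K: "0 < K" using M e by (simp add: K_def)
  define \<kappa> :: real where "\<kappa> = 1 - 2 powr (1 - s)"
  have "(2::real) powr (1 - s) < 2 powr 0" using s by (intro powr_less_mono) auto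
  then have \<kappa>: "0 < \<kappa>" by (simp add: \<kappa>_def)
  \<comment> \<open>solves \<open>c * (1 + e) = c + 1\<close>\<close>
  define c where "c = 1 / e"
  define C where "C = (c + 1) * K / \<kappa>"
  have c: "0 < c" using e by (simp add: c_def)
  have C: "0 < C" using c K \<kappa> by (simp add: C_def)
  show thesis
  proof (rule that[OF c C])
    fix \<sigma> \<sigma>1 \<sigma>2 F1 F2 n n1 n2 :: real
    assume h: "0 < \<sigma>1" "0 < \<sigma>2" "b * \<sigma>1 \<le> \<sigma>" "\<sigma>2 \<le> \<sigma>" "0 \<le> F2" "F2 \<le> F1" "0 \<le> n" "0 \<le> n1" "0 \<le> n2"
      "n \<le> (F1 + F2) * \<sigma> powr (p - 1)" "n2 \<le> F2 * \<sigma>2 powr (p - 1)"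
      "\<And>d. 0 < d \<Longrightarrow> n \<le> (1 + d) powr p * n1 + (1 + 1 / d) powr p * n2"
    have \<sigma>: "0 < \<sigma>" using h(2,4) by simp
    define G where "G = n * \<sigma> powr (1 - p)"
    define G1 where "G1 = n1 * \<sigma>1 powr (1 - p)"
    define G2 where "G2 = n2 * \<sigma>2 powr (1 - p)"
    have inv: "\<sigma> powr (p - 1) * \<sigma> powr (1 - p) = 1" using \<sigma> by (simp add: powr_add[symmetric])
    have G: "0 \<le> G" "0 \<le> G1" "0 \<le> G2" using h by (auto simp: G_def G1_def G2_def)
    have "G \<le> (F1 + F2) * (\<sigma> powr (p - 1) * \<sigma> powr (1 - p))"
      using mult_right_mono[OF h(10), of "\<sigma> powr (1 - p)"] by (simp add: G_def mult.assoc)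
    then have GF: "G \<le> F1 + F2" by (simp add: inv)
    have gain: "F1 powr s + F2 powr s + \<kappa> * (F2 * (F1 + F2) powr (s - 1)) \<le> (F1 + F2) powr s"
      unfolding \<kappa>_def by (rule powr_superadditive_gain) (use s h in auto)
    have gain': "C * F1 powr s + C * F2 powr s + (c + 1) * K * (F2 * (F1 + F2) powr (s - 1)) \<le> C * (F1 + F2) powr s"
    proof -
      have "C * (\<kappa> * (F2 * (F1 + F2) powr (s - 1))) = (c + 1) * K * (F2 * (F1 + F2) powr (s - 1))"
        using \<kappa> by (simp add: C_def)
      then show ?thesis
        using mult_left_mono[OF gain, of C] C unfolding distrib_left by linarith
    qed
    have nn: "0 \<le> K * (F2 * (F1 + F2) powr (s - 1))" using K h by simp
    have "(c + 1) * G powr s + C * F1 powr s + C * F2 powr s \<le> C * (F1 + F2) powr s + c * G1 powr s + c * G2 powr s"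
    \<comment> \<open>first case: superadditivity of \<open>F powr s\<close>; second case: growth of \<open>G\<close> towards the first half\<close>
    proof (cases "G \<le> K * F2")
      case True
      have "G powr s = G * G powr (s - 1)" using powr_mult_base[OF G(1), of "s - 1"] by simp
      also have "\<dots> \<le> (K * F2) * (F1 + F2) powr (s - 1)"
        using True G GF s K h by (intro mult_mono powr_mono2) auto
      finally have "(c + 1) * G powr s \<le> (c + 1) * (K * (F2 * (F1 + F2) powr (s - 1)))"
        using c by (intro mult_left_mono) (auto simp: mult.assoc)
      moreover have "0 \<le> c * G1 powr s" "0 \<le> c * G2 powr s" using c by auto
      ultimately show ?thesis using gain' by (simp add: mult.assoc)
    next
      case False
      have "M * n2 \<le> M * (F2 * \<sigma> powr (p - 1))"
        using M h(2,4,5,11) p by (intro mult_left_mono order_trans[OF h(11)] powr_mono2) auto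
      also have "\<dots> = e * (K * F2) * \<sigma> powr (p - 1)" using e by (simp add: K_def)
      also have "\<dots> \<le> e * G * \<sigma> powr (p - 1)" using False e by (intro mult_right_mono mult_left_mono) auto
      also have "\<dots> = e * n" using inv by (simp add: G_def mult.assoc mult.commute[of "\<sigma> powr (1 - p)"])
      finally have "n \<le> (1 + e) * n1 + e * n" using h(12)[OF d] unfolding dp M_def[symmetric] by linarith
      then have n1: "(1 - e) * n \<le> (1 + e) * n1" by (simp add: algebra_simps)
      have "\<sigma>1 \<le> \<sigma> / b" using h(3) b by (simp add: field_simps)
      then have "(\<sigma> / b) powr (1 - p) \<le> \<sigma>1 powr (1 - p)" using h(1) p by (intro powr_mono2') auto
      moreover have "(\<sigma> / b) powr (1 - p) = B * \<sigma> powr (1 - p)"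
        using \<sigma> b by (simp add: B_def powr_divide powr_diff field_simps)
      ultimately have \<sigma>B: "B * \<sigma> powr (1 - p) \<le> \<sigma>1 powr (1 - p)" by simp
      have "(1 + e) * ((1 + e) * G) = ((1 + e) * (1 + e)) * G" by simp
      also have "\<dots> \<le> ((1 - e) * B) * G" using eB G by (intro mult_right_mono) auto
      also have "\<dots> = ((1 - e) * n) * (B * \<sigma> powr (1 - p))" by (simp add: G_def)
      also have "\<dots> \<le> ((1 + e) * n1) * \<sigma>1 powr (1 - p)"
        by (rule mult_mono) (use n1 \<sigma>B e h(8) B \<sigma> in auto)
      also have "\<dots> = (1 + e) * G1" by (simp add: G1_def)
      finally have "(1 + e) * G \<le> G1" using e by (simp del: distrib_left distrib_right)
      then have "((1 + e) * G) powr s \<le> G1 powr s" using e G s by (intro powr_mono2) auto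
      moreover have "(1 + e) * G powr s \<le> ((1 + e) * G) powr s"
      proof -
        have "(1 + e) powr 1 \<le> (1 + e) powr s" using e s by (intro powr_mono) auto
        then show ?thesis using e G by (simp add: powr_mult mult_right_mono)
      qed
      ultimately have "c * ((1 + e) * G powr s) \<le> c * G1 powr s" using c by (intro mult_left_mono) auto
      moreover have "c * ((1 + e) * G powr s) = (c + 1) * G powr s" using e by (simp add: c_def field_simps)
      moreover have "0 \<le> (c + 1) * K * (F2 * (F1 + F2) powr (s - 1))"
        using c nn by (simp add: mult.assoc)
      moreover have "0 \<le> c * G2 powr s" using c by auto
      ultimately show ?thesis using gain' by linarith
    qed
    then show "(c + 1) * (n * \<sigma> powr (1 - p)) powr s + C * F1 powr s + C * F2 powr s
        \<le> C * (F1 + F2) powr s + c * (n1 * \<sigma>1 powr (1 - p)) powr s + c * (n2 * \<sigma>2 powr (1 - p)) powr s"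
      unfolding G_def G1_def G2_def .
  qed
qed

text \<open>
  By symmetry either half may be the heavier one: replacing \<open>d\<close> by \<open>1 / d\<close> exchanges the roles of \<open>n1\<close>
  and \<open>n2\<close> in the triangle inequality.
\<close>

lemma bellman_step:
  fixes p s b :: real
  assumes p: "1 < p" and s: "1 < s" and b: "1 < b"
  obtains c C where "0 < c" "0 < C"
    "\<And>\<sigma> \<sigma>1 \<sigma>2 F1 F2 n n1 n2.
      \<lbrakk>0 < \<sigma>1; 0 < \<sigma>2; b * \<sigma>1 \<le> \<sigma>; b * \<sigma>2 \<le> \<sigma>; 0 \<le> F1; 0 \<le> F2; 0 \<le> n; 0 \<le> n1; 0 \<le> n2;
        n \<le> (F1 + F2) * \<sigma> powr (p - 1); n1 \<le> F1 * \<sigma>1 powr (p - 1); n2 \<le> F2 * \<sigma>2 powr (p - 1);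
        \<And>d. 0 < d \<Longrightarrow> n \<le> (1 + d) powr p * n1 + (1 + 1 / d) powr p * n2\<rbrakk> \<Longrightarrow>
      (c + 1) * (n * \<sigma> powr (1 - p)) powr s + C * F1 powr s + C * F2 powr s
        \<le> C * (F1 + F2) powr s + c * (n1 * \<sigma>1 powr (1 - p)) powr s + c * (n2 * \<sigma>2 powr (1 - p)) powr s"
proof -
  from bellman_one_sided[OF assms] obtain c C where c: "0 < c" "0 < C"
    and one: "\<And>\<sigma> \<sigma>1 \<sigma>2 F1 F2 n n1 n2.
      \<lbrakk>0 < \<sigma>1; 0 < \<sigma>2; b * \<sigma>1 \<le> \<sigma>; \<sigma>2 \<le> \<sigma>; 0 \<le> F2; F2 \<le> F1; 0 \<le> n; 0 \<le> n1; 0 \<le> n2;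
        n \<le> (F1 + F2) * \<sigma> powr (p - 1); n2 \<le> F2 * \<sigma>2 powr (p - 1);
        \<And>d. 0 < d \<Longrightarrow> n \<le> (1 + d) powr p * n1 + (1 + 1 / d) powr p * n2\<rbrakk> \<Longrightarrow>
      (c + 1) * (n * \<sigma> powr (1 - p)) powr s + C * F1 powr s + C * F2 powr s
        \<le> C * (F1 + F2) powr s + c * (n1 * \<sigma>1 powr (1 - p)) powr s + c * (n2 * \<sigma>2 powr (1 - p)) powr s"
    by blast
  show thesis
  proof (rule that[OF c])
    fix \<sigma> \<sigma>1 \<sigma>2 F1 F2 n n1 n2 :: real
    assume h: "0 < \<sigma>1" "0 < \<sigma>2" "b * \<sigma>1 \<le> \<sigma>" "b * \<sigma>2 \<le> \<sigma>" "0 \<le> F1" "0 \<le> F2" "0 \<le> n" "0 \<le> n1" "0 \<le> n2"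
      "n \<le> (F1 + F2) * \<sigma> powr (p - 1)" "n1 \<le> F1 * \<sigma>1 powr (p - 1)" "n2 \<le> F2 * \<sigma>2 powr (p - 1)"
      and d: "\<And>d. 0 < d \<Longrightarrow> n \<le> (1 + d) powr p * n1 + (1 + 1 / d) powr p * n2"
    have le: "\<sigma>1 \<le> \<sigma>" "\<sigma>2 \<le> \<sigma>"
      using h(1-4) b mult_right_mono[of 1 b \<sigma>1] mult_right_mono[of 1 b \<sigma>2] by linarith+
    have d': "n \<le> (1 + d) powr p * n2 + (1 + 1 / d) powr p * n1" if "0 < d" for d
      using d[of "1 / d"] that by simp
    show "(c + 1) * (n * \<sigma> powr (1 - p)) powr s + C * F1 powr s + C * F2 powr s
        \<le> C * (F1 + F2) powr s + c * (n1 * \<sigma>1 powr (1 - p)) powr s + c * (n2 * \<sigma>2 powr (1 - p)) powr s"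
    proof (cases "F2 \<le> F1")
      case True
      show ?thesis by (rule one) (use h le d True in auto)
    next
      case False
      have "(c + 1) * (n * \<sigma> powr (1 - p)) powr s + C * F2 powr s + C * F1 powr s
        \<le> C * (F2 + F1) powr s + c * (n2 * \<sigma>2 powr (1 - p)) powr s + c * (n1 * \<sigma>1 powr (1 - p)) powr s"
        by (rule one) (use h le d' False in \<open>auto simp: add.commute\<close>)
      then show ?thesis by (simp add: add_ac)
    qed
  qed
qed

section \<open>Summation over a dyadic tree\<close>

lemma nn_integral_count_space_ge_point:
  "f x \<le> (\<integral>\<^sup>+y. f y \<partial>count_space UNIV)"
proof -
  have "f x = (\<integral>\<^sup>+y. f x * indicator {x} y \<partial>count_space UNIV)"
    by (subst nn_integral_cmult_indicator) auto
  also have "\<dots> \<le> (\<integral>\<^sup>+y. f y \<partial>count_space UNIV)"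
    by (intro nn_integral_mono) (auto simp: indicator_def)
  finally show ?thesis .
qed

lemma nn_integral_count_space_int_le:
  fixes f :: "int \<Rightarrow> ennreal"
  assumes "\<And>A. finite A \<Longrightarrow> sum f A \<le> B"
  shows "(\<integral>\<^sup>+k. f k \<partial>count_space UNIV) \<le> B"
proof -
  have "(\<integral>\<^sup>+k. f k \<partial>count_space UNIV) = (\<integral>\<^sup>+n. f (int_decode n) \<partial>count_space UNIV)"
    by (rule nn_integral_bij_count_space[symmetric]) (rule bij_int_decode)
  also have "\<dots> = (\<Sum>n. f (int_decode n))" by (rule nn_integral_count_space_nat)
  also have "\<dots> \<le> B"
  proof (rule suminf_le_const)
    show "(\<Sum>i<n. f (int_decode i)) \<le> B" for n
      using assms[of "int_decode ` {..<n}"] by (simp add: sum.reindex inj_int_decode inj_on_subset[OF inj_int_decode])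
  qed auto
  finally show ?thesis .
qed

text \<open>
  Summing first over the two children \<open>2 * j\<close>, \<open>2 * j + 1\<close> of each node amounts to summing over the next
  level.
\<close>

lemma nn_integral_count_space_even_odd:
  fixes f :: "int \<Rightarrow> ennreal"
  shows "(\<integral>\<^sup>+j. f (2 * j) + f (2 * j + 1) \<partial>count_space UNIV) = (\<integral>\<^sup>+j. f j \<partial>count_space UNIV)"
proof -
  have "bij (\<lambda>(j, e). 2 * j + of_bool e :: int)"
  proof (rule bij_betw_byWitness[where f' = "\<lambda>i. (i div 2, odd i)"])
  qed auto
  then have "(\<integral>\<^sup>+j. f j \<partial>count_space UNIV) = (\<integral>\<^sup>+z. f (case z of (j, e) \<Rightarrow> 2 * j + of_bool e) \<partial>count_space UNIV)"
    by (rule nn_integral_bij_count_space[symmetric])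
  also have "\<dots> = (\<integral>\<^sup>+j. \<integral>\<^sup>+e. f (2 * j + of_bool e) \<partial>count_space UNIV \<partial>count_space UNIV)"
    by (subst nn_integral_fst_count_space[symmetric]) simp
  also have "\<dots> = (\<integral>\<^sup>+j. f (2 * j) + f (2 * j + 1) \<partial>count_space UNIV)"
    by (simp add: nn_integral_count_space_finite UNIV_bool add.commute)
  finally show ?thesis ..
qed

text \<open>
  The node \<open>(k, j)\<close> has the children \<open>(k - 1, 2 * j)\<close> and \<open>(k - 1, 2 * j + 1)\<close>. Summing the Bellman
  inequality over a level \<open>k\<close> gives \<open>S k \<le> C (E k - E (k - 1)) + c (S (k - 1) - S k)\<close> for the level sums
  \<open>S\<close> of \<open>(n \<sigma> powr (1 - p)) powr s\<close> and \<open>E\<close> of \<open>F powr s\<close>. Both are bounded by \<open>T powr s\<close>, so the sum over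
  any range of levels telescopes to at most \<open>(C + c) T powr s\<close>.
\<close>

lemma dyadic_tree_embedding:
  fixes p s b :: real
  assumes p: "1 < p" and s: "1 < s" and b: "1 < b"
  obtains K where "0 < K"
    "\<And>(\<sigma> :: int \<Rightarrow> int \<Rightarrow> real) F n T.
      \<lbrakk>\<And>k j. 0 < \<sigma> k j; \<And>k j. b * \<sigma> (k - 1) (2 * j) \<le> \<sigma> k j; \<And>k j. b * \<sigma> (k - 1) (2 * j + 1) \<le> \<sigma> k j;
        \<And>k j. 0 \<le> F k j; \<And>k j. F k j = F (k - 1) (2 * j) + F (k - 1) (2 * j + 1);
        \<And>k j. F k j \<le> T; \<And>k. (\<integral>\<^sup>+j. ennreal (F k j) \<partial>count_space UNIV) \<le> ennreal T;
        \<And>k j. 0 \<le> n k j; \<And>k j. n k j \<le> F k j * \<sigma> k j powr (p - 1);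
        \<And>k j d. 0 < d \<Longrightarrow> n k j \<le> (1 + d) powr p * n (k - 1) (2 * j) + (1 + 1 / d) powr p * n (k - 1) (2 * j + 1)\<rbrakk> \<Longrightarrow>
      (\<integral>\<^sup>+(k, j). ennreal ((n k j * \<sigma> k j powr (1 - p)) powr s) \<partial>count_space UNIV) \<le> ennreal (K * T powr s)"
proof -
  from bellman_step[OF assms] obtain c C where c: "0 < c" "0 < C"
    and step: "\<And>\<sigma> \<sigma>1 \<sigma>2 F1 F2 n n1 n2.
      \<lbrakk>0 < \<sigma>1; 0 < \<sigma>2; b * \<sigma>1 \<le> \<sigma>; b * \<sigma>2 \<le> \<sigma>; 0 \<le> F1; 0 \<le> F2; 0 \<le> n; 0 \<le> n1; 0 \<le> n2;
        n \<le> (F1 + F2) * \<sigma> powr (p - 1); n1 \<le> F1 * \<sigma>1 powr (p - 1); n2 \<le> F2 * \<sigma>2 powr (p - 1);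
        \<And>d. 0 < d \<Longrightarrow> n \<le> (1 + d) powr p * n1 + (1 + 1 / d) powr p * n2\<rbrakk> \<Longrightarrow>
      (c + 1) * (n * \<sigma> powr (1 - p)) powr s + C * F1 powr s + C * F2 powr s
        \<le> C * (F1 + F2) powr s + c * (n1 * \<sigma>1 powr (1 - p)) powr s + c * (n2 * \<sigma>2 powr (1 - p)) powr s"
    by blast
  show thesis
  proof (rule that[of "C + c"])
    show "0 < C + c" using c by simp
    fix \<sigma> F n :: "int \<Rightarrow> int \<Rightarrow> real" and T :: real
    assume \<sigma>: "\<And>k j. 0 < \<sigma> k j" "\<And>k j. b * \<sigma> (k - 1) (2 * j) \<le> \<sigma> k j" "\<And>k j. b * \<sigma> (k - 1) (2 * j + 1) \<le> \<sigma> k j"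
      and F: "\<And>k j. 0 \<le> F k j" "\<And>k j. F k j = F (k - 1) (2 * j) + F (k - 1) (2 * j + 1)"
        "\<And>k j. F k j \<le> T" "\<And>k. (\<integral>\<^sup>+j. ennreal (F k j) \<partial>count_space UNIV) \<le> ennreal T"
      and n: "\<And>k j. 0 \<le> n k j" "\<And>k j. n k j \<le> F k j * \<sigma> k j powr (p - 1)"
        "\<And>k j d. 0 < d \<Longrightarrow> n k j \<le> (1 + d) powr p * n (k - 1) (2 * j) + (1 + 1 / d) powr p * n (k - 1) (2 * j + 1)"
    have T: "0 \<le> T" using F(1,3) order_trans by blast
    define G where "G k j = n k j * \<sigma> k j powr (1 - p)" for k j
    define S where "S k = (\<integral>\<^sup>+j. ennreal (G k j powr s) \<partial>count_space UNIV)" for k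
    define E where "E k = (\<integral>\<^sup>+j. ennreal (F k j powr s) \<partial>count_space UNIV)" for k
    have G: "0 \<le> G k j" "G k j \<le> F k j" for k j
    proof -
      show "0 \<le> G k j" using n(1) by (simp add: G_def)
      have "G k j \<le> F k j * (\<sigma> k j powr (p - 1) * \<sigma> k j powr (1 - p))"
        using mult_right_mono[OF n(2)[of k j], of "\<sigma> k j powr (1 - p)"] by (simp add: G_def mult.assoc)
      then show "G k j \<le> F k j" using \<sigma>(1)[of k j] by (simp add: powr_add[symmetric])
    qed
    have E: "E k \<le> ennreal (T powr s)" for k
    proof -
      have "E k \<le> (\<integral>\<^sup>+j. ennreal (T powr (s - 1)) * ennreal (F k j) \<partial>count_space UNIV)"
        unfolding E_def
      proof (rule nn_integral_mono)
        fix j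
        have "F k j powr s = F k j * F k j powr (s - 1)" using powr_mult_base[OF F(1), of k j "s - 1"] by simp
        also have "\<dots> \<le> F k j * T powr (s - 1)" using F(1,3) s by (intro mult_left_mono powr_mono2) auto
        finally show "ennreal (F k j powr s) \<le> ennreal (T powr (s - 1)) * ennreal (F k j)"
          using F(1) by (simp add: ennreal_mult[symmetric] mult.commute ennreal_leI)
      qed
      also have "\<dots> \<le> ennreal (T powr (s - 1)) * ennreal T"
        by (subst nn_integral_cmult) (auto intro!: mult_left_mono F(4))
      also have "\<dots> = ennreal (T powr s)"
        using T powr_mult_base[OF T, of "s - 1"] by (simp add: ennreal_mult[symmetric] mult.commute)
      finally show ?thesis .
    qed
    have S: "S k \<le> E k" for k
      unfolding S_def E_def using s G by (intro nn_integral_mono ennreal_leI powr_mono2) auto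
    have level: "ennreal (c + 1) * S k + ennreal C * E (k - 1) \<le> ennreal C * E k + ennreal c * S (k - 1)" for k
    proof -
      have "ennreal (c + 1) * S k + ennreal C * E (k - 1) =
          (\<integral>\<^sup>+j. ennreal ((c + 1) * G k j powr s + C * F (k - 1) (2 * j) powr s + C * F (k - 1) (2 * j + 1) powr s) \<partial>count_space UNIV)"
        unfolding S_def E_def using c
        by (subst nn_integral_count_space_even_odd[symmetric])
           (simp add: nn_integral_cmult[symmetric] nn_integral_add[symmetric] ennreal_mult distrib_left add.assoc del: ennreal_plus_if)
      also have "\<dots> \<le> (\<integral>\<^sup>+j. ennreal (C * F k j powr s + c * G (k - 1) (2 * j) powr s + c * G (k - 1) (2 * j + 1) powr s) \<partial>count_space UNIV)"
      proof (intro nn_integral_mono ennreal_leI)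
        fix j
        show "(c + 1) * G k j powr s + C * F (k - 1) (2 * j) powr s + C * F (k - 1) (2 * j + 1) powr s
          \<le> C * F k j powr s + c * G (k - 1) (2 * j) powr s + c * G (k - 1) (2 * j + 1) powr s"
          unfolding F(2)[of k j] G_def
          by (rule step) (use \<sigma> F(1) n F(2)[of k j, symmetric] in auto)
      qed
      also have "\<dots> = ennreal C * E k + ennreal c * S (k - 1)"
        unfolding S_def E_def using c
        by (subst nn_integral_count_space_even_odd[of "\<lambda>j. ennreal (G (k - 1) j powr s)", symmetric])
           (simp add: nn_integral_cmult[symmetric] nn_integral_add[symmetric] ennreal_mult distrib_left add.assoc del: ennreal_plus_if)
      finally show ?thesis .
    qed
    define S' E' where "S' k = enn2real (S k)" and "E' k = enn2real (E k)" for k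
    \<comment> \<open>the level sums are finite, so that they may be subtracted from one another\<close>
    have EE: "E k = ennreal (E' k)" "0 \<le> E' k" "E' k \<le> T powr s" for k
    proof -
      show "E k = ennreal (E' k)" unfolding E'_def using E[of k] by (simp add: le_less_trans[OF _ ennreal_less_top])
      then show "E' k \<le> T powr s" using E[of k] by (simp add: ennreal_le_iff)
      show "0 \<le> E' k" by (simp add: E'_def)
    qed
    have SS: "S k = ennreal (S' k)" "0 \<le> S' k" "S' k \<le> T powr s" for k
    proof -
      note le = order_trans[OF S[of k] E[of k]]
      show "S k = ennreal (S' k)" unfolding S'_def using le by (simp add: le_less_trans[OF _ ennreal_less_top])
      then show "S' k \<le> T powr s" using le by (simp add: ennreal_le_iff)
      show "0 \<le> S' k" by (simp add: S'_def)
    qed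
    have level': "S' k \<le> C * (E' k - E' (k - 1)) + c * (S' (k - 1) - S' k)" for k
    proof -
      have "ennreal ((c + 1) * S' k + C * E' (k - 1)) \<le> ennreal (C * E' k + c * S' (k - 1))"
        using level[of k] c EE(2) SS(2) unfolding EE(1) SS(1)
        by (simp add: ennreal_mult[symmetric] ennreal_plus[symmetric] del: ennreal_plus)
      then have "(c + 1) * S' k + C * E' (k - 1) \<le> C * E' k + c * S' (k - 1)"
        using c EE(2) SS(2) by (subst (asm) ennreal_le_iff) auto
      then show ?thesis by (simp add: algebra_simps)
    qed
    have tele: "(\<Sum>i<m. S' (a + int i + 1)) \<le> C * (E' (a + int m) - E' a) + c * (S' a - S' (a + int m))" for a m
    proof (induction m)
      case (Suc m)
      then show ?case using level'[of "a + int m + 1"] by (simp add: algebra_simps)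
    qed simp
    have fin: "sum S A \<le> ennreal ((C + c) * T powr s)" if "finite A" for A
    proof -
      obtain m :: nat where m: "A \<subseteq> {- int m..int m}"
      proof -
        define m where "m = Max (insert 0 ((\<lambda>k. nat \<bar>k\<bar>) ` A))"
        have "nat \<bar>k\<bar> \<le> m" if "k \<in> A" for k using that \<open>finite A\<close> by (auto simp: m_def intro!: Max_ge)
        then have "A \<subseteq> {- int m..int m}" by force
        then show ?thesis using that by blast
      qed
      have "sum S' A \<le> sum S' {- int m..int m}" using m SS(2) by (intro sum_mono2) auto
      also have "\<dots> = (\<Sum>i<2 * m + 1. S' ((- int m - 1) + int i + 1))"
        by (rule sum.reindex_bij_witness[of _ "\<lambda>i. int i - int m" "\<lambda>k. nat (k + int m)"]) auto
      also have "\<dots> \<le> C * (E' (- int m - 1 + int (2 * m + 1)) - E' (- int m - 1)) + c * (S' (- int m - 1) - S' (- int m - 1 + int (2 * m + 1)))"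
        by (rule tele)
      also have "\<dots> \<le> C * T powr s + c * T powr s"
        using c EE(2,3) SS(2,3) by (intro add_mono mult_left_mono) (smt (verit))+
      finally show ?thesis
        unfolding SS(1) using SS(2) by (subst sum_ennreal) (auto intro!: ennreal_leI simp: algebra_simps)
    qed
    have "(\<integral>\<^sup>+(k, j). ennreal ((n k j * \<sigma> k j powr (1 - p)) powr s) \<partial>count_space UNIV) = (\<integral>\<^sup>+k. S k \<partial>count_space UNIV)"
      unfolding S_def G_def by (subst nn_integral_fst_count_space[symmetric]) simp
    also have "\<dots> \<le> ennreal ((C + c) * T powr s)"
      by (rule nn_integral_count_space_int_le) (rule fin)
    finally show "(\<integral>\<^sup>+(k, j). ennreal ((n k j * \<sigma> k j powr (1 - p)) powr s) \<partial>count_space UNIV) \<le> ennreal ((C + c) * T powr s)" .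
  qed
qed

section \<open>Dyadic intervals\<close>

text \<open>
  The parametrisation by level and position is used in sums: distinct indices give distinct intervals.
\<close>

definition dyad :: "int \<Rightarrow> int \<Rightarrow> real set" where
  "dyad k j = {2 powi k * of_int j ..< 2 powi k * (of_int j + 1)}"

lemma dyad_in_dyadic_intervals: "dyad k j \<in> dyadic_intervals"
  by (auto simp: dyad_def dyadic_intervals_def)

lemma measurable_dyad [measurable, simp]: "dyad k j \<in> sets borel"
  by (simp add: dyad_def)

lemma mem_dyad_iff: "x \<in> dyad k j \<longleftrightarrow> \<lfloor>x / 2 powi k\<rfloor> = j"
  by (simp add: dyad_def floor_eq_iff pos_le_divide_eq pos_divide_less_eq mult.commute)

lemma measure_dyad: "measure lebesgue (dyad k j) = 2 powi k"
  by (simp add: dyad_def algebra_simps)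

lemma emeasure_dyad_nonzero: "emeasure lborel (dyad k j) \<noteq> 0"
proof -
  have "2 powi k * of_int j \<le> (2 powi k :: real) * (of_int j + 1)" by (intro mult_left_mono) auto
  then show ?thesis by (simp add: dyad_def algebra_simps ennreal_eq_0_iff not_le)
qed

lemma dyad_split:
  "dyad k j = dyad (k - 1) (2 * j) \<union> dyad (k - 1) (2 * j + 1)"
  "dyad (k - 1) (2 * j) \<inter> dyad (k - 1) (2 * j + 1) = {}"
proof -
  have k: "(2::real) powi k = 2 * 2 powi (k - 1)"
    using power_int_add_1'[of "2::real" "k - 1"] by simp
  show "dyad k j = dyad (k - 1) (2 * j) \<union> dyad (k - 1) (2 * j + 1)"
    unfolding dyad_def k using zero_less_power_int[of "2::real" "k - 1"] by (auto simp: algebra_simps)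
  show "dyad (k - 1) (2 * j) \<inter> dyad (k - 1) (2 * j + 1) = {}"
    by (auto simp: mem_dyad_iff)
qed

lemma indicator_dyad_split:
  "(indicator (dyad k j) x :: ennreal) = indicator (dyad (k - 1) (2 * j)) x + indicator (dyad (k - 1) (2 * j + 1)) x"
  using dyad_split[of k j] by (subst dyad_split(1)) (auto simp: indicator_def)

lemma nn_integral_dyad_split:
  assumes [measurable]: "f \<in> borel_measurable borel"
  shows "(\<integral>\<^sup>+y\<in>dyad k j. f y \<partial>lborel) =
    (\<integral>\<^sup>+y\<in>dyad (k - 1) (2 * j). f y \<partial>lborel) + (\<integral>\<^sup>+y\<in>dyad (k - 1) (2 * j + 1). f y \<partial>lborel)"
  by (subst indicator_dyad_split) (simp add: distrib_left nn_integral_add)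

lemma nn_integral_indicator_dyad: "(\<integral>\<^sup>+j. indicator (dyad k j) x \<partial>count_space UNIV) = (1 :: ennreal)"
proof -
  have "(\<integral>\<^sup>+j. indicator (dyad k j) x \<partial>count_space UNIV) = (\<integral>\<^sup>+j. (1 :: ennreal) * indicator {\<lfloor>x / 2 powi k\<rfloor>} j \<partial>count_space UNIV)"
    by (intro nn_integral_cong) (auto simp: mem_dyad_iff indicator_def)
  also have "\<dots> = 1" by (subst nn_integral_cmult_indicator) auto
  finally show ?thesis .
qed

lemma sum_nn_integral_dyad:
  assumes [measurable]: "f \<in> borel_measurable borel"
  shows "(\<integral>\<^sup>+j. (\<integral>\<^sup>+y\<in>dyad k j. f y \<partial>lborel) \<partial>count_space UNIV) = (\<integral>\<^sup>+y. f y \<partial>lborel)"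
  by (subst nn_integral_count_space_nn_integral[symmetric])
     (auto simp: nn_integral_cmult nn_integral_indicator_dyad)

text \<open>
  The dyadic interval together with its two neighbours of the same length.
\<close>

definition dyad3 :: "int \<Rightarrow> int \<Rightarrow> real set" where
  "dyad3 k j = {2 powi k * (of_int j - 1) ..< 2 powi k * (of_int j + 2)}"

lemma measurable_dyad3 [measurable, simp]: "dyad3 k j \<in> sets borel"
  by (simp add: dyad3_def)

lemma mem_dyad3_iff: "x \<in> dyad3 k j \<longleftrightarrow> \<bar>\<lfloor>x / 2 powi k\<rfloor> - j\<bar> \<le> 1"
proof -
  have "x \<in> dyad3 k j \<longleftrightarrow> of_int (j - 1) \<le> x / 2 powi k \<and> x / 2 powi k < of_int (j + 2)"
    by (simp add: dyad3_def pos_le_divide_eq pos_divide_less_eq mult.commute)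
  then show ?thesis by (simp only: le_floor_iff[symmetric] floor_less_iff[symmetric]) auto
qed

lemma measure_dyad3: "measure lebesgue (dyad3 k j) = 3 * 2 powi k"
  by (simp add: dyad3_def algebra_simps)

lemma dyad3_bounded_interval: "dyad3 k j \<in> bounded_intervals"
  using measure_dyad3[of k j] by (auto simp: bounded_intervals_def dyad3_def is_interval_co)

lemma dyad_subset_dyad3: "dyad k j \<subseteq> dyad3 k j"
  by (auto simp: mem_dyad_iff mem_dyad3_iff)

section \<open>Weighted dyadic embeddings\<close>

text \<open>
  The dual measure \<open>\<sigma>\<close> of the weight \<open>u\<close>.
\<close>

definition dual_mass :: "real \<Rightarrow> (real \<Rightarrow> real) \<Rightarrow> real set \<Rightarrow> ennreal" where
  "dual_mass p u A = (\<integral>\<^sup>+x\<in>A. ennreal (u x powr (- conj_exponent p)) \<partial>lborel)"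

text \<open>
  The dyadic Carleson-type embedding for functions of \<open>y\<close> with values in \<open>L\<^sup>p(M)\<close>. The number \<open>n\<close>
  attached to an interval is the integral over \<open>M\<close> of the \<open>p\<close>-th power of the integral in \<open>y\<close>, and
  \<open>F\<close> is the corresponding integral of \<open>H powr p\<close>. Hoelder's inequality gives \<open>n \<le> F \<sigma> powr (p - 1)\<close>
  pointwise in \<open>x\<close>, and the approximate triangle inequality for \<open>n\<close> is likewise an integrated
  pointwise one.
\<close>

lemma dyadic_embedding_vector:
  fixes u :: "real \<Rightarrow> real"
  assumes p: "1 < p" and s: "1 < s" and b: "1 < b"
    and u[measurable]: "u \<in> borel_measurable borel" and u0: "\<And>x. 0 < u x"
    and fin: "\<And>k j. dual_mass p u (dyad k j) < \<infinity>"
    and pos: "\<And>k j. 0 < dual_mass p u (dyad k j)"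
    and rd: "\<And>k j. ennreal b * dual_mass p u (dyad (k - 1) (2 * j)) \<le> dual_mass p u (dyad k j)"
      "\<And>k j. ennreal b * dual_mass p u (dyad (k - 1) (2 * j + 1)) \<le> dual_mass p u (dyad k j)"
  obtains K where "0 < K" "\<And>(M :: 'a measure) H T.
    \<lbrakk>H \<in> borel_measurable (M \<Otimes>\<^sub>M lborel); 0 \<le> T; (\<integral>\<^sup>+x. \<integral>\<^sup>+y. ennreal_pow (H (x, y)) p \<partial>lborel \<partial>M) \<le> ennreal T\<rbrakk> \<Longrightarrow>
    (\<integral>\<^sup>+(k, j). ennreal_pow ((\<integral>\<^sup>+x. ennreal_pow (\<integral>\<^sup>+y\<in>dyad k j. H (x, y) * ennreal (1 / u y) \<partial>lborel) p \<partial>M)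
        * ennreal (enn2real (dual_mass p u (dyad k j)) powr (1 - p))) s \<partial>count_space UNIV) \<le> ennreal (K * T powr s)"
proof (rule dyadic_tree_embedding[OF p s b])
  fix K assume K: "0 < K" and
    emb: "\<And>(\<sigma> :: int \<Rightarrow> int \<Rightarrow> real) F n T.
      \<lbrakk>\<And>k j. 0 < \<sigma> k j; \<And>k j. b * \<sigma> (k - 1) (2 * j) \<le> \<sigma> k j; \<And>k j. b * \<sigma> (k - 1) (2 * j + 1) \<le> \<sigma> k j;
        \<And>k j. 0 \<le> F k j; \<And>k j. F k j = F (k - 1) (2 * j) + F (k - 1) (2 * j + 1);
        \<And>k j. F k j \<le> T; \<And>k. (\<integral>\<^sup>+j. ennreal (F k j) \<partial>count_space UNIV) \<le> ennreal T;
        \<And>k j. 0 \<le> n k j; \<And>k j. n k j \<le> F k j * \<sigma> k j powr (p - 1);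
        \<And>k j d. 0 < d \<Longrightarrow> n k j \<le> (1 + d) powr p * n (k - 1) (2 * j) + (1 + 1 / d) powr p * n (k - 1) (2 * j + 1)\<rbrakk> \<Longrightarrow>
      (\<integral>\<^sup>+(k, j). ennreal ((n k j * \<sigma> k j powr (1 - p)) powr s) \<partial>count_space UNIV) \<le> ennreal (K * T powr s)"
  define \<sigma> where "\<sigma> k j = enn2real (dual_mass p u (dyad k j))" for k j
  have \<sigma>: "dual_mass p u (dyad k j) = ennreal (\<sigma> k j)" "0 < \<sigma> k j" for k j
    using fin[of k j] pos[of k j] by (auto simp: \<sigma>_def enn2real_positive_iff)
  have rd': "b * \<sigma> (k - 1) (2 * j) \<le> \<sigma> k j" "b * \<sigma> (k - 1) (2 * j + 1) \<le> \<sigma> k j" for k j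
  proof -
    have nn: "0 \<le> \<sigma> k' j'" for k' j' using \<sigma>(2) by (simp add: less_imp_le)
    show "b * \<sigma> (k - 1) (2 * j) \<le> \<sigma> k j" "b * \<sigma> (k - 1) (2 * j + 1) \<le> \<sigma> k j"
      using rd[of k j] b nn unfolding \<sigma>(1) by (simp_all add: ennreal_mult[symmetric] ennreal_le_iff)
  qed
  show thesis
  proof (rule that[OF K])
    fix M :: "'a measure" and H :: "'a \<times> real \<Rightarrow> ennreal" and T :: real
    assume H[measurable]: "H \<in> borel_measurable (M \<Otimes>\<^sub>M lborel)"
      and T: "0 \<le> T" "(\<integral>\<^sup>+x. \<integral>\<^sup>+y. ennreal_pow (H (x, y)) p \<partial>lborel \<partial>M) \<le> ennreal T"
    define N where "N k j x = (\<integral>\<^sup>+y\<in>dyad k j. H (x, y) * ennreal (1 / u y) \<partial>lborel)" for k j x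
    define P where "P k j x = (\<integral>\<^sup>+y\<in>dyad k j. ennreal_pow (H (x, y)) p \<partial>lborel)" for k j x
    have [measurable]: "N k j \<in> borel_measurable M" "P k j \<in> borel_measurable M" for k j
      unfolding N_def P_def by measurable
    define F where "F k j = enn2real (\<integral>\<^sup>+x. P k j x \<partial>M)" for k j
    define n where "n k j = enn2real (\<integral>\<^sup>+x. ennreal_pow (N k j x) p \<partial>M)" for k j
    have sect: "(\<lambda>y. H (x, y)) \<in> borel_measurable borel" if "x \<in> space M" for x
      using measurable_Pair2[OF H that] by simp
    have Ple: "(\<integral>\<^sup>+x. P k j x \<partial>M) \<le> ennreal T" for k j
      unfolding P_def by (intro order_trans[OF _ T(2)] nn_integral_mono) (auto simp: indicator_def)
    have F: "(\<integral>\<^sup>+x. P k j x \<partial>M) = ennreal (F k j)" "0 \<le> F k j" "F k j \<le> T" for k j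
    proof -
      show 1: "(\<integral>\<^sup>+x. P k j x \<partial>M) = ennreal (F k j)"
        unfolding F_def using Ple[of k j] by (simp add: le_less_trans[OF _ ennreal_less_top])
      show "0 \<le> F k j" by (simp add: F_def)
      show "F k j \<le> T" using Ple[of k j] T(1) unfolding 1 by (simp add: ennreal_le_iff)
    qed
    have Fsplit: "F k j = F (k - 1) (2 * j) + F (k - 1) (2 * j + 1)" for k j
    proof -
      have "ennreal (F k j) = (\<integral>\<^sup>+x. P (k - 1) (2 * j) x + P (k - 1) (2 * j + 1) x \<partial>M)"
        unfolding F(1)[symmetric]
        by (intro nn_integral_cong, unfold P_def, rule nn_integral_dyad_split)
           (use sect in measurable)
      also have "\<dots> = ennreal (F (k - 1) (2 * j) + F (k - 1) (2 * j + 1))"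
        using F(2) by (simp add: nn_integral_add F(1))
      finally show ?thesis using F(2) by (simp add: ennreal_plus[symmetric] del: ennreal_plus)
    qed
    have Fsum: "(\<integral>\<^sup>+j. ennreal (F k j) \<partial>count_space UNIV) \<le> ennreal T" for k
    proof -
      have "(\<integral>\<^sup>+j. ennreal (F k j) \<partial>count_space UNIV) = (\<integral>\<^sup>+x. \<integral>\<^sup>+j. P k j x \<partial>count_space UNIV \<partial>M)"
        unfolding F(1)[symmetric] by (rule nn_integral_count_space_nn_integral[symmetric]) auto
      also have "\<dots> = (\<integral>\<^sup>+x. \<integral>\<^sup>+y. ennreal_pow (H (x, y)) p \<partial>lborel \<partial>M)"
        by (intro nn_integral_cong, unfold P_def, rule sum_nn_integral_dyad) (use sect in measurable)
      finally show ?thesis using T(2) by simp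
    qed
    have nF: "(\<integral>\<^sup>+x. ennreal_pow (N k j x) p \<partial>M) \<le> ennreal (F k j * \<sigma> k j powr (p - 1))" for k j
    proof -
      have "(\<integral>\<^sup>+x. ennreal_pow (N k j x) p \<partial>M) \<le> (\<integral>\<^sup>+x. P k j x * ennreal (\<sigma> k j powr (p - 1)) \<partial>M)"
      proof (rule nn_integral_mono)
        fix x assume "x \<in> space M"
        then show "ennreal_pow (N k j x) p \<le> P k j x * ennreal (\<sigma> k j powr (p - 1))"
          using Hoelder_on_set[OF p, of "\<lambda>y. H (x, y)" lborel u "dyad k j"] sect[of x] u u0
            fin[of k j] \<sigma>(2)[of k j]
          unfolding N_def P_def dual_mass_def[symmetric] \<sigma>(1) by (simp add: ennreal_pow_ennreal less_imp_le)
      qed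
      also have "\<dots> = ennreal (F k j * \<sigma> k j powr (p - 1))"
        using F(2) by (simp add: nn_integral_multc F(1) ennreal_mult)
      finally show ?thesis .
    qed
    have n: "(\<integral>\<^sup>+x. ennreal_pow (N k j x) p \<partial>M) = ennreal (n k j)" "0 \<le> n k j" "n k j \<le> F k j * \<sigma> k j powr (p - 1)" for k j
    proof -
      show 1: "(\<integral>\<^sup>+x. ennreal_pow (N k j x) p \<partial>M) = ennreal (n k j)"
        unfolding n_def using nF[of k j] by (simp add: le_less_trans[OF _ ennreal_less_top])
      show "0 \<le> n k j" by (simp add: n_def)
      show "n k j \<le> F k j * \<sigma> k j powr (p - 1)" using nF[of k j] F(2) unfolding 1 by (subst (asm) ennreal_le_iff) auto
    qed
    have nsub: "n k j \<le> (1 + d) powr p * n (k - 1) (2 * j) + (1 + 1 / d) powr p * n (k - 1) (2 * j + 1)"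
      if "0 < d" for k j d
    proof -
      have "ennreal (n k j) \<le> (\<integral>\<^sup>+x. ennreal ((1 + d) powr p) * ennreal_pow (N (k - 1) (2 * j) x) p
          + ennreal ((1 + 1 / d) powr p) * ennreal_pow (N (k - 1) (2 * j + 1) x) p \<partial>M)"
        unfolding n(1)[symmetric]
      proof (rule nn_integral_mono)
        fix x assume x: "x \<in> space M"
        have "N k j x = N (k - 1) (2 * j) x + N (k - 1) (2 * j + 1) x"
          unfolding N_def by (rule nn_integral_dyad_split) (use sect[OF x] in measurable)
        then show "ennreal_pow (N k j x) p \<le> ennreal ((1 + d) powr p) * ennreal_pow (N (k - 1) (2 * j) x) p
          + ennreal ((1 + 1 / d) powr p) * ennreal_pow (N (k - 1) (2 * j + 1) x) p"
          using ennreal_pow_add_le[of p d] p that by simp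
      qed
      also have "\<dots> = ennreal ((1 + d) powr p * n (k - 1) (2 * j) + (1 + 1 / d) powr p * n (k - 1) (2 * j + 1))"
        using n(2) by (simp add: nn_integral_add nn_integral_cmult n(1) ennreal_mult)
      finally show ?thesis using n(2) by (subst (asm) ennreal_le_iff) auto
    qed
    have "(\<integral>\<^sup>+(k, j). ennreal_pow ((\<integral>\<^sup>+x. ennreal_pow (N k j x) p \<partial>M) * ennreal (\<sigma> k j powr (1 - p))) s \<partial>count_space UNIV)
      = (\<integral>\<^sup>+(k, j). ennreal ((n k j * \<sigma> k j powr (1 - p)) powr s) \<partial>count_space UNIV)"
      using n(2) by (simp add: n(1) ennreal_mult[symmetric] ennreal_pow_ennreal)
    also have "\<dots> \<le> ennreal (K * T powr s)"
      by (rule emb[where \<sigma> = \<sigma> and F = F and n = n and T = T, OF \<sigma>(2) rd' F(2) Fsplit F(3) Fsum n(2,3) nsub])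
    finally show "(\<integral>\<^sup>+(k, j). ennreal_pow ((\<integral>\<^sup>+x. ennreal_pow (\<integral>\<^sup>+y\<in>dyad k j. H (x, y) * ennreal (1 / u y) \<partial>lborel) p \<partial>M)
        * ennreal (enn2real (dual_mass p u (dyad k j)) powr (1 - p))) s \<partial>count_space UNIV) \<le> ennreal (K * T powr s)"
      unfolding N_def \<sigma>_def .
  qed
qed

text \<open>
  Two applications of the vector-valued embedding. For a fixed interval in \<open>y\<close> the scalar case,
  obtained with a one-point measure space, sums over the intervals in \<open>x\<close>; what remains is the
  integral in \<open>x\<close> of the \<open>p\<close>-th power of an integral in \<open>y\<close>, which is the quantity that the embedding with
  values in \<open>L\<^sup>p\<close> of the line sums over the intervals in \<open>y\<close>.
\<close>

lemma strong_dyadic_embedding: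
  fixes u1 u2 :: "real \<Rightarrow> real"
  assumes p: "1 < p" and s: "1 < s" and b: "1 < b1" "1 < b2"
    and u[measurable]: "u1 \<in> borel_measurable borel" "u2 \<in> borel_measurable borel"
    and u0: "\<And>x. 0 < u1 x" "\<And>x. 0 < u2 x"
    and fin: "\<And>k j. dual_mass p u1 (dyad k j) < \<infinity>" "\<And>k j. dual_mass p u2 (dyad k j) < \<infinity>"
    and pos: "\<And>k j. 0 < dual_mass p u1 (dyad k j)" "\<And>k j. 0 < dual_mass p u2 (dyad k j)"
    and rd1: "\<And>k j. ennreal b1 * dual_mass p u1 (dyad (k - 1) (2 * j)) \<le> dual_mass p u1 (dyad k j)"
      "\<And>k j. ennreal b1 * dual_mass p u1 (dyad (k - 1) (2 * j + 1)) \<le> dual_mass p u1 (dyad k j)"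
    and rd2: "\<And>k j. ennreal b2 * dual_mass p u2 (dyad (k - 1) (2 * j)) \<le> dual_mass p u2 (dyad k j)"
      "\<And>k j. ennreal b2 * dual_mass p u2 (dyad (k - 1) (2 * j + 1)) \<le> dual_mass p u2 (dyad k j)"
  obtains K where "0 < K" "\<And>H T.
    \<lbrakk>H \<in> borel_measurable (lborel \<Otimes>\<^sub>M lborel); 0 \<le> T; (\<integral>\<^sup>+x. \<integral>\<^sup>+y. ennreal_pow (H (x, y)) p \<partial>lborel \<partial>lborel) \<le> ennreal T\<rbrakk> \<Longrightarrow>
    (\<integral>\<^sup>+(l, m). \<integral>\<^sup>+(k, j). ennreal_pow (ennreal_pow (\<integral>\<^sup>+x\<in>dyad k j. (\<integral>\<^sup>+y\<in>dyad l m. H (x, y) * ennreal (1 / u2 y) \<partial>lborel) * ennreal (1 / u1 x) \<partial>lborel) p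
        * ennreal ((enn2real (dual_mass p u1 (dyad k j)) * enn2real (dual_mass p u2 (dyad l m))) powr (1 - p))) s
      \<partial>count_space UNIV \<partial>count_space UNIV) \<le> ennreal (K * T powr s)"
proof (rule dyadic_embedding_vector[OF p s b(1) u(1) u0(1) fin(1) pos(1) rd1, where ?'a = unit])
  fix K1 assume K1: "0 < K1" and
    emb1: "\<And>(M :: unit measure) H T.
    \<lbrakk>H \<in> borel_measurable (M \<Otimes>\<^sub>M lborel); 0 \<le> T; (\<integral>\<^sup>+x. \<integral>\<^sup>+y. ennreal_pow (H (x, y)) p \<partial>lborel \<partial>M) \<le> ennreal T\<rbrakk> \<Longrightarrow>
    (\<integral>\<^sup>+(k, j). ennreal_pow ((\<integral>\<^sup>+x. ennreal_pow (\<integral>\<^sup>+y\<in>dyad k j. H (x, y) * ennreal (1 / u1 y) \<partial>lborel) p \<partial>M)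
        * ennreal (enn2real (dual_mass p u1 (dyad k j)) powr (1 - p))) s \<partial>count_space UNIV) \<le> ennreal (K1 * T powr s)"
  \<comment> \<open>if the integral on the right is infinite, the bound is trivial\<close>
  have line: "(\<integral>\<^sup>+(k, j). ennreal_pow (ennreal_pow (\<integral>\<^sup>+x\<in>dyad k j. X x * ennreal (1 / u1 x) \<partial>lborel) p
        * ennreal (enn2real (dual_mass p u1 (dyad k j)) powr (1 - p))) s \<partial>count_space UNIV)
      \<le> ennreal K1 * ennreal_pow (\<integral>\<^sup>+x. ennreal_pow (X x) p \<partial>lborel) s"
    if X[measurable]: "X \<in> borel_measurable borel" for X :: "real \<Rightarrow> ennreal"
  proof (cases "\<integral>\<^sup>+x. ennreal_pow (X x) p \<partial>lborel")
    case (real t)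
    have "(\<lambda>z. X (snd z)) \<in> borel_measurable (count_space (UNIV :: unit set) \<Otimes>\<^sub>M lborel)" by measurable
    from emb1[OF this, of t] real show ?thesis
      using K1 by (simp add: nn_integral_count_space_finite UNIV_unit ennreal_pow_ennreal ennreal_mult)
  qed (use K1 in \<open>simp add: ennreal_mult_top\<close>)
  show thesis
  proof (rule dyadic_embedding_vector[OF p s b(2) u(2) u0(2) fin(2) pos(2) rd2, where ?'a = real])
    fix K2 assume K2: "0 < K2" and
      emb2: "\<And>(M :: real measure) H T.
      \<lbrakk>H \<in> borel_measurable (M \<Otimes>\<^sub>M lborel); 0 \<le> T; (\<integral>\<^sup>+x. \<integral>\<^sup>+y. ennreal_pow (H (x, y)) p \<partial>lborel \<partial>M) \<le> ennreal T\<rbrakk> \<Longrightarrow>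
      (\<integral>\<^sup>+(k, j). ennreal_pow ((\<integral>\<^sup>+x. ennreal_pow (\<integral>\<^sup>+y\<in>dyad k j. H (x, y) * ennreal (1 / u2 y) \<partial>lborel) p \<partial>M)
          * ennreal (enn2real (dual_mass p u2 (dyad k j)) powr (1 - p))) s \<partial>count_space UNIV) \<le> ennreal (K2 * T powr s)"
    show thesis
    proof (rule that[of "K1 * K2"])
      show "0 < K1 * K2" using K1 K2 by simp
      fix H :: "real \<times> real \<Rightarrow> ennreal" and T :: real
      assume H[measurable]: "H \<in> borel_measurable (lborel \<Otimes>\<^sub>M lborel)" and T: "0 \<le> T"
        "(\<integral>\<^sup>+x. \<integral>\<^sup>+y. ennreal_pow (H (x, y)) p \<partial>lborel \<partial>lborel) \<le> ennreal T"
      define X where "X l m x = (\<integral>\<^sup>+y\<in>dyad l m. H (x, y) * ennreal (1 / u2 y) \<partial>lborel)" for l m x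
      have X[measurable]: "X l m \<in> borel_measurable borel" for l m
      proof -
        have "X l m \<in> borel_measurable lborel" unfolding X_def by measurable
        then show ?thesis by simp
      qed
      define \<sigma>1 where "\<sigma>1 k j = enn2real (dual_mass p u1 (dyad k j))" for k j
      define \<sigma>2 where "\<sigma>2 k j = enn2real (dual_mass p u2 (dyad k j))" for k j
      \<comment> \<open>the weight belonging to the interval in \<open>y\<close> is constant in the inner sum\<close>
      have factor: "ennreal_pow (y * ennreal ((\<sigma>1 k j * \<sigma>2 l m) powr (1 - p))) s
          = ennreal_pow (ennreal (\<sigma>2 l m powr (1 - p))) s * ennreal_pow (y * ennreal (\<sigma>1 k j powr (1 - p))) s" for k j l m y
        by (simp add: ennreal_pow_mult[symmetric] powr_mult ennreal_mult \<sigma>1_def \<sigma>2_def mult_ac)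
      have "(\<integral>\<^sup>+(l, m). \<integral>\<^sup>+(k, j). ennreal_pow (ennreal_pow (\<integral>\<^sup>+x\<in>dyad k j. X l m x * ennreal (1 / u1 x) \<partial>lborel) p
          * ennreal ((\<sigma>1 k j * \<sigma>2 l m) powr (1 - p))) s \<partial>count_space UNIV \<partial>count_space UNIV)
        = (\<integral>\<^sup>+(l, m). ennreal_pow (ennreal (\<sigma>2 l m powr (1 - p))) s *
            (\<integral>\<^sup>+(k, j). ennreal_pow (ennreal_pow (\<integral>\<^sup>+x\<in>dyad k j. X l m x * ennreal (1 / u1 x) \<partial>lborel) p
              * ennreal (\<sigma>1 k j powr (1 - p))) s \<partial>count_space UNIV) \<partial>count_space UNIV)"
        unfolding factor by (simp add: split_beta' nn_integral_cmult)
      also have "\<dots> \<le> (\<integral>\<^sup>+(l, m). ennreal K1 * ennreal_pow ((\<integral>\<^sup>+x. ennreal_pow (X l m x) p \<partial>lborel)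
            * ennreal (\<sigma>2 l m powr (1 - p))) s \<partial>count_space UNIV)"
      proof (rule nn_integral_mono, clarify)
        fix l m
        show "ennreal_pow (ennreal (\<sigma>2 l m powr (1 - p))) s *
            (\<integral>\<^sup>+(k, j). ennreal_pow (ennreal_pow (\<integral>\<^sup>+x\<in>dyad k j. X l m x * ennreal (1 / u1 x) \<partial>lborel) p
              * ennreal (\<sigma>1 k j powr (1 - p))) s \<partial>count_space UNIV)
          \<le> ennreal K1 * ennreal_pow ((\<integral>\<^sup>+x. ennreal_pow (X l m x) p \<partial>lborel) * ennreal (\<sigma>2 l m powr (1 - p))) s"
          using mult_left_mono[OF line[OF X, of l m], of "ennreal_pow (ennreal (\<sigma>2 l m powr (1 - p))) s"]
          unfolding \<sigma>1_def by (simp add: ennreal_pow_mult mult_ac)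
      qed
      also have "\<dots> = ennreal K1 * (\<integral>\<^sup>+(l, m). ennreal_pow ((\<integral>\<^sup>+x. ennreal_pow (X l m x) p \<partial>lborel)
            * ennreal (\<sigma>2 l m powr (1 - p))) s \<partial>count_space UNIV)"
        by (simp add: split_beta' nn_integral_cmult)
      also have "\<dots> \<le> ennreal K1 * ennreal (K2 * T powr s)"
        using emb2[OF H T] unfolding X_def \<sigma>2_def by (intro mult_left_mono) auto
      also have "\<dots> = ennreal (K1 * K2 * T powr s)"
        using K1 K2 by (simp add: ennreal_mult[symmetric] mult.assoc)
      finally show "(\<integral>\<^sup>+(l, m). \<integral>\<^sup>+(k, j). ennreal_pow (ennreal_pow (\<integral>\<^sup>+x\<in>dyad k j. (\<integral>\<^sup>+y\<in>dyad l m. H (x, y) * ennreal (1 / u2 y) \<partial>lborel) * ennreal (1 / u1 x) \<partial>lborel) p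
        * ennreal ((enn2real (dual_mass p u1 (dyad k j)) * enn2real (dual_mass p u2 (dyad l m))) powr (1 - p))) s
      \<partial>count_space UNIV \<partial>count_space UNIV) \<le> ennreal (K1 * K2 * T powr s)"
        unfolding X_def \<sigma>1_def \<sigma>2_def .
    qed
  qed
qed

section \<open>Domination of the maximal function by dyadic averages\<close>

lemma interval_diameter_le:
  assumes "I \<in> bounded_intervals" "x \<in> I" "y \<in> I"
  shows "\<bar>x - y\<bar> \<le> measure lebesgue I"
proof -
  have I: "is_interval I" "bounded I" using assms by (auto simp: bounded_intervals_def)
  have m: "I \<in> lmeasurable" using I by (auto intro!: measurable_convex is_interval_convex)
  have "{min x y..max x y} \<subseteq> I"
    using mem_is_interval_1_I[OF I(1), of "min x y" "max x y"] assms(2,3)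
    by (auto simp: min_def max_def)
  then have "measure lebesgue {min x y..max x y} \<le> measure lebesgue I"
    using m by (intro measure_mono_fmeasurable) auto
  then show ?thesis by (auto simp: min_def max_def split: if_splits)
qed

text \<open>
  Choose the dyadic length with \<open>2 powi k / 2 \<le> \<bar>I\<bar> \<le> 2 powi k\<close>; the points of \<open>I\<close> have distance at
  most \<open>2 powi k\<close> from \<open>x\<close>, hence lie in the dyadic interval of \<open>x\<close> or next to it.
\<close>

lemma bounded_interval_dyad:
  assumes I: "I \<in> bounded_intervals" "x \<in> I"
  obtains k j where "2 powi k / 2 \<le> measure lebesgue I" "measure lebesgue I \<le> 2 powi k"
    "x \<in> dyad k j" "I \<subseteq> (\<Union>i\<in>{j-1, j, j+1}. dyad k i)"
proof -
  define m where "m = measure lebesgue I"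
  have m: "0 < m" using I by (auto simp: bounded_intervals_def m_def)
  define k where "k = \<lceil>log 2 m\<rceil>"
  have powi: "(2::real) powi i = 2 powr (of_int i)" for i by (simp add: powr_real_of_int')
  have "m = 2 powr (log 2 m)" using m by simp
  also have "\<dots> \<le> 2 powi k" unfolding powi k_def by (intro powr_mono) auto
  finally have up: "m \<le> 2 powi k" .
  have "2 powi k / 2 = (2::real) powr (of_int k - 1)" unfolding powi by (simp add: powr_diff)
  also have "\<dots> \<le> 2 powr (log 2 m)" unfolding k_def by (intro powr_mono) linarith+
  also have "\<dots> = m" using m by simp
  finally have lo: "2 powi k / 2 \<le> m" .
  define j where "j = \<lfloor>x / 2 powi k\<rfloor>"
  have "I \<subseteq> (\<Union>i\<in>{j-1, j, j+1}. dyad k i)"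
  proof
    fix y assume "y \<in> I"
    then have "\<bar>x - y\<bar> \<le> 2 powi k" using interval_diameter_le[OF I, of y] up by (simp add: m_def)
    then have "\<bar>x / 2 powi k - y / 2 powi k\<bar> \<le> 1"
      by (simp add: diff_divide_distrib[symmetric] abs_divide)
    then have "\<bar>\<lfloor>y / 2 powi k\<rfloor> - j\<bar> \<le> 1" unfolding j_def by linarith
    then have "\<lfloor>y / 2 powi k\<rfloor> \<in> {j-1, j, j+1}" by auto
    then show "y \<in> (\<Union>i\<in>{j-1, j, j+1}. dyad k i)" by (auto simp: mem_dyad_iff)
  qed
  then show thesis using that[of k j] up lo by (simp add: m_def mem_dyad_iff j_def)
qed

lemma powr_length_le:
  fixes a L m :: real
  assumes "0 < a" "a < 1" "0 < L" "L / 2 \<le> m"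
  shows "m powr (a - 1) \<le> 2 * L powr (a - 1)"
proof -
  have "m powr (a - 1) \<le> (L / 2) powr (a - 1)" using assms by (intro powr_mono2') auto
  also have "\<dots> = 2 powr (1 - a) * L powr (a - 1)" using assms by (simp add: powr_divide powr_diff field_simps)
  also have "2 powr (1 - a) \<le> 2 powr 1" using assms by (intro powr_mono) auto
  finally show ?thesis by (simp add: mult_right_mono)
qed

lemma borel_rectangle_lebesgue [measurable]:
  fixes A B :: "real set"
  shows "A \<in> sets borel \<Longrightarrow> B \<in> sets borel \<Longrightarrow> A \<times> B \<in> sets (lebesgue :: (real \<times> real) measure)"
  by (intro sets_completionI_sets) (simp add: lborel_prod[symmetric])

text \<open>
  The rectangle \<open>I \<times> J\<close> is covered by nine dyadic rectangles whose triples contain \<open>(x, y)\<close>, and replacing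
  \<open>\<bar>I\<bar>\<close> and \<open>\<bar>J\<bar>\<close> by the dyadic lengths costs a factor \<open>2\<close> each: \<open>36 = 9 * 4\<close>.
\<close>

lemma strong_frac_max_dyadic_bound:
  fixes f :: "real \<times> real \<Rightarrow> real"
  assumes f[measurable]: "f \<in> borel_measurable lebesgue"
    and a: "0 < \<alpha> x" "\<alpha> x < 1" and b: "0 < \<beta> y" "\<beta> y < 1"
    and bound: "\<And>k j l m. x \<in> dyad3 k j \<Longrightarrow> y \<in> dyad3 l m \<Longrightarrow>
      ennreal ((2 powi k) powr (\<alpha> x - 1) * (2 powi l) powr (\<beta> y - 1)) * (\<integral>\<^sup>+u\<in>dyad k j \<times> dyad l m. ennreal \<bar>f u\<bar> \<partial>lebesgue) \<le> B"
  shows "strong_frac_max \<alpha> \<beta> f (x, y) \<le> 36 * B"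
  unfolding strong_frac_max_def prod.case
proof (intro SUP_least, safe)
  fix I J assume I: "I \<in> bounded_intervals" "x \<in> I" and J: "J \<in> bounded_intervals" "y \<in> J"
  obtain k j where kj: "2 powi k / 2 \<le> measure lebesgue I" "measure lebesgue I \<le> 2 powi k"
    "x \<in> dyad k j" "I \<subseteq> (\<Union>i\<in>{j-1, j, j+1}. dyad k i)" using bounded_interval_dyad[OF I] .
  obtain l m where lm: "2 powi l / 2 \<le> measure lebesgue J" "measure lebesgue J \<le> 2 powi l"
    "y \<in> dyad l m" "J \<subseteq> (\<Union>i\<in>{m-1, m, m+1}. dyad l i)" using bounded_interval_dyad[OF J] .
  define N1 N2 where "N1 = {j-1, j, j+1}" and "N2 = {m-1, m, m+1}"
  have N: "finite N1" "finite N2" "card (N1 \<times> N2) = 9"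
    by (auto simp: N1_def N2_def card_cartesian_product card_insert_if)
  define w where "w = (2 powi k) powr (\<alpha> x - 1) * (2 powi l) powr (\<beta> y - 1)"
  have w: "measure lebesgue I powr (\<alpha> x - 1) * measure lebesgue J powr (\<beta> y - 1) \<le> 4 * w"
  proof -
    have "measure lebesgue I powr (\<alpha> x - 1) * measure lebesgue J powr (\<beta> y - 1) \<le>
        (2 * (2 powi k) powr (\<alpha> x - 1)) * (2 * (2 powi l) powr (\<beta> y - 1))"
      by (intro mult_mono powr_length_le) (use a b kj lm in auto)
    then show ?thesis by (simp add: w_def)
  qed
  have "(\<integral>\<^sup>+u\<in>I \<times> J. ennreal \<bar>f u\<bar> \<partial>lebesgue)
      \<le> (\<integral>\<^sup>+u. (\<Sum>(i, i')\<in>N1 \<times> N2. ennreal \<bar>f u\<bar> * indicator (dyad k i \<times> dyad l i') u) \<partial>lebesgue)"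
  proof (rule nn_integral_mono)
    fix u :: "real \<times> real"
    show "ennreal \<bar>f u\<bar> * indicator (I \<times> J) u \<le> (\<Sum>(i, i')\<in>N1 \<times> N2. ennreal \<bar>f u\<bar> * indicator (dyad k i \<times> dyad l i') u)"
    proof (cases "u \<in> I \<times> J")
      case True
      then obtain i i' where "i \<in> N1" "i' \<in> N2" "u \<in> dyad k i \<times> dyad l i'"
        using kj(4) lm(4) unfolding N1_def N2_def by blast
      then show ?thesis
        using N True
        by (intro order_trans[OF _ member_le_sum[of "(i, i')"]]) auto
    qed simp
  qed
  also have "\<dots> = (\<Sum>(i, i')\<in>N1 \<times> N2. (\<integral>\<^sup>+u\<in>dyad k i \<times> dyad l i'. ennreal \<bar>f u\<bar> \<partial>lebesgue))"
    by (simp add: split_beta' nn_integral_sum)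
  finally have int_le: "(\<integral>\<^sup>+u\<in>I \<times> J. ennreal \<bar>f u\<bar> \<partial>lebesgue)
      \<le> (\<Sum>(i, i')\<in>N1 \<times> N2. (\<integral>\<^sup>+u\<in>dyad k i \<times> dyad l i'. ennreal \<bar>f u\<bar> \<partial>lebesgue))" .
  have "ennreal (measure lebesgue I powr (\<alpha> x - 1) * measure lebesgue J powr (\<beta> y - 1)) * (\<integral>\<^sup>+u\<in>I \<times> J. ennreal \<bar>f u\<bar> \<partial>lebesgue)
      \<le> ennreal (4 * w) * (\<Sum>(i, i')\<in>N1 \<times> N2. (\<integral>\<^sup>+u\<in>dyad k i \<times> dyad l i'. ennreal \<bar>f u\<bar> \<partial>lebesgue))"
    by (rule mult_mono[OF ennreal_leI[OF w] int_le]) auto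
  also have "\<dots> = 4 * (\<Sum>(i, i')\<in>N1 \<times> N2. ennreal w * (\<integral>\<^sup>+u\<in>dyad k i \<times> dyad l i'. ennreal \<bar>f u\<bar> \<partial>lebesgue))"
    by (simp add: w_def ennreal_mult sum_distrib_left split_beta' mult.assoc)
  also have "\<dots> \<le> 4 * (\<Sum>(i, i')\<in>N1 \<times> N2. B)"
  proof (intro mult_left_mono sum_mono, clarify)
    fix i i' assume "i \<in> N1" "i' \<in> N2"
    then have "x \<in> dyad3 k i" "y \<in> dyad3 l i'"
      using kj(3) lm(3) by (auto simp: N1_def N2_def mem_dyad_iff mem_dyad3_iff)
    then show "ennreal w * (\<integral>\<^sup>+u\<in>dyad k i \<times> dyad l i'. ennreal \<bar>f u\<bar> \<partial>lebesgue) \<le> B"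
      unfolding w_def by (rule bound)
  qed simp
  also have "\<dots> = 36 * B"
    using N(3) by (simp add: split_beta' mult.assoc[symmetric])
  finally show "ennreal (measure lebesgue I powr (\<alpha> x - 1) * measure lebesgue J powr (\<beta> y - 1)) * (\<integral>\<^sup>+u\<in>I \<times> J. ennreal \<bar>f u\<bar> \<partial>lebesgue) \<le> 36 * B" .
qed

section \<open>The Luxemburg norm\<close>

text \<open>
  With a strict bound on the norm, some admissible \<open>\<lambda>\<close> lies below \<open>L\<close>, so that neither the attainment
  of the infimum nor any measurability has to be discussed.
\<close>

lemma modular_le_one_of_lux_norm_less:
  assumes "lux_norm E q F < ennreal L" "\<And>z. 0 \<le> q z" "\<And>z. z \<in> E \<Longrightarrow> G z \<le> F z"
  shows "(\<integral>\<^sup>+z\<in>E. ennreal_pow (G z / ennreal L) (q z) \<partial>lebesgue) \<le> 1"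
proof -
  obtain l where l: "0 < l" "(\<integral>\<^sup>+z\<in>E. ennreal_pow (F z / ennreal l) (q z) \<partial>lebesgue) \<le> 1" "l < L"
    using assms(1) unfolding lux_norm_def by (auto simp: INF_less_iff ennreal_less_iff)
  have "(\<integral>\<^sup>+z\<in>E. ennreal_pow (G z / ennreal L) (q z) \<partial>lebesgue) \<le> (\<integral>\<^sup>+z\<in>E. ennreal_pow (F z / ennreal l) (q z) \<partial>lebesgue)"
  proof (rule nn_integral_mono)
    fix z
    show "ennreal_pow (G z / ennreal L) (q z) * indicator E z \<le> ennreal_pow (F z / ennreal l) (q z) * indicator E z"
    proof (cases "z \<in> E")
      case True
      have "G z / ennreal L \<le> F z / ennreal L"
        using assms(3)[OF True] by (rule divide_right_mono_ennreal)
      also have "\<dots> \<le> F z / ennreal l"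
        using l unfolding divide_ennreal_def
        by (intro mult_left_mono) (auto simp: inverse_ennreal intro!: ennreal_leI le_imp_inverse_le)
      finally show ?thesis using assms(2) by (intro mult_right_mono ennreal_pow_mono) auto
    qed simp
  qed
  then show ?thesis using l(2) by simp
qed

lemma lux_norm_le:
  assumes "0 < l" "(\<integral>\<^sup>+z\<in>E. ennreal_pow (F z / ennreal l) (q z) \<partial>lebesgue) \<le> 1"
  shows "lux_norm E q F \<le> ennreal l"
  unfolding lux_norm_def by (rule INF_lower) (use assms in auto)

lemma lux_norm_scale_le:
  assumes "0 < c" "\<And>z. 0 \<le> q z" "\<And>z. z \<in> E \<Longrightarrow> ennreal c * F z \<le> G z"
  shows "ennreal c * lux_norm E q F \<le> lux_norm UNIV q G"
  unfolding lux_norm_def[of UNIV]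
proof (rule INF_greatest)
  fix l :: real assume "l \<in> {l. 0 < l \<and> (\<integral>\<^sup>+z\<in>UNIV. ennreal_pow (G z / ennreal l) (q z) \<partial>lebesgue) \<le> 1}"
  then have l: "0 < l" "(\<integral>\<^sup>+z. ennreal_pow (G z / ennreal l) (q z) \<partial>lebesgue) \<le> 1" by auto
  have "(\<integral>\<^sup>+z\<in>E. ennreal_pow (F z / ennreal (l / c)) (q z) \<partial>lebesgue) \<le> (\<integral>\<^sup>+z. ennreal_pow (G z / ennreal l) (q z) \<partial>lebesgue)"
  proof (rule nn_integral_mono)
    fix z
    show "ennreal_pow (F z / ennreal (l / c)) (q z) * indicator E z \<le> ennreal_pow (G z / ennreal l) (q z)"
    proof (cases "z \<in> E")
      case True
      have "F z / ennreal (l / c) = ennreal c * F z / ennreal l"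
        using l assms(1) unfolding divide_ennreal_def
        by (simp add: inverse_ennreal ennreal_mult[symmetric] mult_ac divide_inverse)
           (simp add: ennreal_mult mult_ac)
      also have "\<dots> \<le> G z / ennreal l" using assms(3)[OF True] by (rule divide_right_mono_ennreal)
      finally show ?thesis using True assms(2) by (simp add: ennreal_pow_mono)
    qed simp
  qed
  then have "lux_norm E q F \<le> ennreal (l / c)"
    using l assms(1) by (intro lux_norm_le) auto
  then have "ennreal c * lux_norm E q F \<le> ennreal c * ennreal (l / c)" by (rule mult_left_mono) simp
  also have "\<dots> = ennreal l" using l assms(1) by (simp add: ennreal_mult[symmetric])
  finally show "ennreal c * lux_norm E q F \<le> ennreal l" .
qed

text \<open>
  For \<open>l < 1\<close> and \<open>q \<ge> 1\<close>, modular at most \<open>1\<close> after division by \<open>l\<close> means modular at most \<open>l\<close> before. If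
  the norm vanished, the modular of \<open>m * \<bar>v\<bar>\<close> would vanish and \<open>v\<close> would be \<open>0\<close> almost everywhere on \<open>E\<close>.
\<close>

lemma lux_norm_pos:
  fixes v :: "'a::euclidean_space \<Rightarrow> real"
  assumes v: "is_weight v" and q[measurable]: "q \<in> borel_measurable lebesgue" and q1: "\<And>z. 1 \<le> q z"
    and E[measurable]: "E \<in> sets lebesgue" and E0: "emeasure lebesgue E \<noteq> 0"
    and m: "0 < m" "\<And>z. z \<in> E \<Longrightarrow> ennreal (m * \<bar>v z\<bar>) \<le> F z"
  shows "0 < lux_norm E q F"
proof (rule ccontr)
  assume "\<not> 0 < lux_norm E q F"
  then have lux0: "lux_norm E q F = 0" by (simp add: zero_less_iff_neq_zero)
  have [measurable]: "v \<in> borel_measurable lebesgue" using v by (simp add: is_weight_def)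
  define G where "G = (\<integral>\<^sup>+z\<in>E. ennreal_pow (ennreal (m * \<bar>v z\<bar>)) (q z) \<partial>lebesgue)"
  have small: "G \<le> ennreal l" if "0 < l" "l < 1" for l
  proof -
    have "lux_norm E q F < ennreal l" using lux0 that by simp
    then have "(\<integral>\<^sup>+z\<in>E. ennreal_pow (ennreal (m * \<bar>v z\<bar>) / ennreal l) (q z) \<partial>lebesgue) \<le> 1"
      by (rule modular_le_one_of_lux_norm_less) (use m q1 in \<open>auto intro: order_trans[of 0 1]\<close>)
    then have "ennreal l * (\<integral>\<^sup>+z\<in>E. ennreal_pow (ennreal (m * \<bar>v z\<bar>) / ennreal l) (q z) \<partial>lebesgue) \<le> ennreal l"
      using mult_left_mono[of _ 1 "ennreal l"] by simp
    moreover have "G \<le> ennreal l * (\<integral>\<^sup>+z\<in>E. ennreal_pow (ennreal (m * \<bar>v z\<bar>) / ennreal l) (q z) \<partial>lebesgue)"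
      unfolding G_def
    proof (subst nn_integral_cmult[symmetric], measurable, rule nn_integral_mono)
      fix z
      have "ennreal (m * \<bar>v z\<bar>) = ennreal l * (ennreal (m * \<bar>v z\<bar>) / ennreal l)"
        using that m by (simp add: divide_ennreal ennreal_mult[symmetric])
      then have "ennreal_pow (ennreal (m * \<bar>v z\<bar>)) (q z) = ennreal_pow (ennreal l) (q z) * ennreal_pow (ennreal (m * \<bar>v z\<bar>) / ennreal l) (q z)"
        by (metis ennreal_pow_mult)
      also have "ennreal_pow (ennreal l) (q z) \<le> ennreal_pow (ennreal l) 1"
        using that q1[of z] by (intro ennreal_pow_antimono_exponent) auto
      finally have "ennreal_pow (ennreal (m * \<bar>v z\<bar>)) (q z) \<le> ennreal l * ennreal_pow (ennreal (m * \<bar>v z\<bar>) / ennreal l) (q z)"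
        by (simp add: mult_right_mono)
      then show "ennreal_pow (ennreal (m * \<bar>v z\<bar>)) (q z) * indicator E z
        \<le> ennreal l * (ennreal_pow (ennreal (m * \<bar>v z\<bar>) / ennreal l) (q z) * indicator E z)"
        by (simp add: indicator_def)
    qed
    ultimately show ?thesis by simp
  qed
  have "G \<le> 0"
  proof (rule ennreal_le_epsilon)
    fix e :: real assume "0 < e"
    then have "G \<le> ennreal (min e (1/2))" by (intro small) auto
    also have "\<dots> \<le> 0 + ennreal e" by (auto intro!: ennreal_leI)
    finally show "G \<le> 0 + ennreal e" .
  qed
  then have "AE z in lebesgue. ennreal_pow (ennreal (m * \<bar>v z\<bar>)) (q z) * indicator E z = 0"
    unfolding G_def by (subst nn_integral_0_iff_AE[symmetric]) auto
  moreover have "AE z in lebesgue. 0 < v z" using v by (simp add: is_weight_def)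
  ultimately have "AE z in lebesgue. z \<notin> E"
  proof eventually_elim
    case (elim z)
    then show ?case using m(1) by (auto simp: indicator_def ennreal_eq_0_iff mult_le_0_iff split: if_splits)
  qed
  then have "E \<in> null_sets lebesgue" by (subst AE_iff_null_sets) auto
  then show False using E0 by (simp add: null_sets_def)
qed

section \<open>Completed measures and Borel representatives\<close>

lemma null_sets_cylinder:
  fixes N :: "real set"
  assumes "N \<in> null_sets lborel"
  shows "N \<times> (UNIV :: real set) \<in> null_sets (lborel \<Otimes>\<^sub>M lborel)"
    "(UNIV :: real set) \<times> N \<in> null_sets (lborel \<Otimes>\<^sub>M lborel)"
  using assms by (auto intro!: null_setsI simp: lborel.emeasure_pair_measure_Times null_sets_def)

text \<open>
  The coordinate projections are measurable also for the completed sigma-algebras, because the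
  preimage of a null set is a null set.
\<close>

lemma measurable_fst_lebesgue: "fst \<in> (lebesgue :: (real \<times> real) measure) \<rightarrow>\<^sub>M (lebesgue :: real measure)"
  and measurable_snd_lebesgue: "snd \<in> (lebesgue :: (real \<times> real) measure) \<rightarrow>\<^sub>M (lebesgue :: real measure)"
proof -
  have 1: "fst \<in> (lebesgue :: (real \<times> real) measure) \<rightarrow>\<^sub>M (lborel :: real measure)"
    "snd \<in> (lebesgue :: (real \<times> real) measure) \<rightarrow>\<^sub>M (lborel :: real measure)"
    by (auto intro!: measurable_completion simp: lborel_prod[symmetric])
  have eq: "fst -` N = N \<times> UNIV" "snd -` N = UNIV \<times> N" for N :: "real set" by auto
  show "fst \<in> (lebesgue :: (real \<times> real) measure) \<rightarrow>\<^sub>M (lebesgue :: real measure)"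
  proof (rule completion.measurable_completion2[OF 1(1)], safe)
    fix N :: "real set" assume N: "N \<in> null_sets lborel"
    then show "N \<in> null_sets (distr (lebesgue :: (real \<times> real) measure) lborel fst)"
      using null_sets_cylinder(1)[OF N] 1
      by (subst null_sets_distr_iff) (auto simp: eq lborel_prod null_sets_completionI)
  qed
  show "snd \<in> (lebesgue :: (real \<times> real) measure) \<rightarrow>\<^sub>M (lebesgue :: real measure)"
  proof (rule completion.measurable_completion2[OF 1(2)], safe)
    fix N :: "real set" assume N: "N \<in> null_sets lborel"
    then show "N \<in> null_sets (distr (lebesgue :: (real \<times> real) measure) lborel snd)"
      using null_sets_cylinder(2)[OF N] 1
      by (subst null_sets_distr_iff) (auto simp: eq lborel_prod null_sets_completionI)
  qed
qed

lemma AE_lborel_prod_fst_snd: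
  fixes P Q :: "real \<Rightarrow> bool"
  assumes "AE x in lborel. P x" "AE y in lborel. Q y"
  shows "AE z in lborel \<Otimes>\<^sub>M lborel. P (fst z) \<and> Q (snd z)"
proof -
  obtain N1 where N1: "{x. \<not> P x} \<subseteq> N1" "N1 \<in> null_sets lborel"
    using assms(1) by (auto simp: eventually_ae_filter)
  obtain N2 where N2: "{x. \<not> Q x} \<subseteq> N2" "N2 \<in> null_sets lborel"
    using assms(2) by (auto simp: eventually_ae_filter)
  have "AE z in lborel \<Otimes>\<^sub>M (lborel :: real measure). P (fst z)"
    by (rule AE_I'[OF null_sets_cylinder(1)[OF N1(2)]]) (use N1 in auto)
  moreover have "AE z in (lborel :: real measure) \<Otimes>\<^sub>M lborel. Q (snd z)"
    by (rule AE_I'[OF null_sets_cylinder(2)[OF N2(2)]]) (use N2 in auto)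
  ultimately show ?thesis by eventually_elim auto
qed

text \<open>
  Iterated integrals over the product of Borel measures require Borel measurable weights; positivity
  everywhere makes division harmless.
\<close>

lemma weight_borel_representative:
  fixes w :: "real \<Rightarrow> real"
  assumes "is_weight w"
  obtains u where "u \<in> borel_measurable borel" "\<And>x. 0 < u x" "AE x in lborel. w x = u x"
proof -
  obtain g where g: "g \<in> borel_measurable lborel" "AE x in lborel. w x = g x"
    using assms completion_ex_borel_measurable_real[of w lborel] by (auto simp: is_weight_def)
  have pos: "AE x in lborel. 0 < w x" using assms by (simp add: is_weight_def AE_completion_iff)
  show thesis
  proof (rule that[of "\<lambda>x. if 0 < g x then g x else 1"])
    show "(\<lambda>x. if 0 < g x then g x else 1) \<in> borel_measurable borel" using g(1) by simp
    show "AE x in lborel. w x = (if 0 < g x then g x else 1)"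
      using g(2) pos by eventually_elim auto
  qed auto
qed

lemma dual_mass_eq_lebesgue:
  assumes "AE x in lborel. w x = u x"
  shows "(\<integral>\<^sup>+x\<in>I. ennreal (w x powr (- conj_exponent p)) \<partial>lebesgue) = dual_mass p u I"
  unfolding nn_integral_completion dual_mass_def
  by (rule nn_integral_cong_AE) (use assms in eventually_elim, auto)

lemma dual_mass_pos:
  assumes [measurable]: "u \<in> borel_measurable borel" "A \<in> sets borel"
    and u: "\<And>x. 0 < u x" and A: "emeasure lborel A \<noteq> 0"
  shows "0 < dual_mass p u A"
proof (rule ccontr)
  assume "\<not> 0 < dual_mass p u A"
  then have "AE x in lborel. ennreal (u x powr (- conj_exponent p)) * indicator A x = 0"
    unfolding dual_mass_def by (subst nn_integral_0_iff_AE[symmetric]) (auto simp: zero_less_iff_neq_zero)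
  then have "AE x in lborel. x \<notin> A"
  proof eventually_elim
    case (elim x)
    then show ?case using u[of x] by (auto simp: indicator_def ennreal_eq_0_iff split: if_splits)
  qed
  then have "A \<in> null_sets lborel" by (subst AE_iff_null_sets) auto
  then show False using A by auto
qed

lemma dual_mass_reverse_doubling:
  assumes "dyadic_reverse_doubling (\<lambda>x. w x powr (- conj_exponent p))" "AE x in lborel. w x = u x"
  obtains b where "1 < b"
    "\<And>k j. ennreal b * dual_mass p u (dyad (k - 1) (2 * j)) \<le> dual_mass p u (dyad k j)"
    "\<And>k j. ennreal b * dual_mass p u (dyad (k - 1) (2 * j + 1)) \<le> dual_mass p u (dyad k j)"
proof -
  obtain b where b: "1 < b" and rd: "\<And>I I'. I \<in> dyadic_intervals \<Longrightarrow> I' \<in> dyadic_intervals \<Longrightarrow> I \<subseteq> I' \<Longrightarrow>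
      measure lebesgue I = measure lebesgue I' / 2 \<Longrightarrow> ennreal b * dual_mass p u I \<le> dual_mass p u I'"
    using assms(1) unfolding dyadic_reverse_doubling_def dual_mass_eq_lebesgue[OF assms(2)] by blast
  have half: "(2::real) powi (k - 1) = 2 powi k / 2" for k
    by (simp add: power_int_diff)
  show thesis
  proof (rule that[OF b])
    show "ennreal b * dual_mass p u (dyad (k - 1) (2 * j)) \<le> dual_mass p u (dyad k j)" for k j
    proof -
      have "dyad (k - 1) (2 * j) \<subseteq> dyad k j" using dyad_split(1)[of k j] by blast
      from rd[OF dyad_in_dyadic_intervals dyad_in_dyadic_intervals this] show ?thesis
        by (simp add: measure_dyad half)
    qed
    show "ennreal b * dual_mass p u (dyad (k - 1) (2 * j + 1)) \<le> dual_mass p u (dyad k j)" for k j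
    proof -
      have "dyad (k - 1) (2 * j + 1) \<subseteq> dyad k j" using dyad_split(1)[of k j] by blast
      from rd[OF dyad_in_dyadic_intervals dyad_in_dyadic_intervals this] show ?thesis
        by (simp add: measure_dyad half)
    qed
  qed
qed

section \<open>Weights of product type\<close>

text \<open>
  A product weight in terms of Borel measurable, everywhere positive representatives of its factors.
\<close>

locale product_weight =
  fixes p :: real and w :: "real \<times> real \<Rightarrow> real" and u1 u2 :: "real \<Rightarrow> real"
  assumes p: "1 < p"
    and u[measurable]: "u1 \<in> borel_measurable borel" "u2 \<in> borel_measurable borel"
    and u_pos: "\<And>x. 0 < u1 x" "\<And>x. 0 < u2 x"
    and w_eq: "AE z in lborel. w z = u1 (fst z) * u2 (snd z)"
begin

lemma conj_exponent_pos: "0 < conj_exponent p"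
  using p by (simp add: conj_exponent_def)

lemma dual_mass_rectangle:
  assumes [measurable]: "A \<in> sets borel" "B \<in> sets borel"
  shows "(\<integral>\<^sup>+z\<in>A \<times> B. ennreal ((u1 (fst z) * u2 (snd z)) powr (- conj_exponent p)) \<partial>lebesgue)
    = dual_mass p u1 A * dual_mass p u2 B"
proof -
  have "(\<integral>\<^sup>+z\<in>A \<times> B. ennreal ((u1 (fst z) * u2 (snd z)) powr (- conj_exponent p)) \<partial>lebesgue)
      = (\<integral>\<^sup>+z. (ennreal (u1 (fst z) powr (- conj_exponent p)) * indicator A (fst z))
          * (ennreal (u2 (snd z) powr (- conj_exponent p)) * indicator B (snd z)) \<partial>lborel)"
    unfolding nn_integral_completion
  proof (rule nn_integral_cong)
    fix z :: "real \<times> real"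
    show "ennreal ((u1 (fst z) * u2 (snd z)) powr (- conj_exponent p)) * indicator (A \<times> B) z
      = (ennreal (u1 (fst z) powr (- conj_exponent p)) * indicator A (fst z))
          * (ennreal (u2 (snd z) powr (- conj_exponent p)) * indicator B (snd z))"
      using u_pos(1)[of "fst z"] u_pos(2)[of "snd z"]
      by (cases z) (auto simp: indicator_def powr_mult ennreal_mult[symmetric])
  qed
  also have "\<dots> = dual_mass p u1 A * dual_mass p u2 B"
    unfolding dual_mass_def lborel_prod[symmetric]
    by (subst lborel.nn_integral_fst[symmetric]) (simp_all add: nn_integral_cmult nn_integral_multc)
  finally show ?thesis .
qed

lemma Lp_norm_inverse_weight:
  assumes AB: "A \<in> sets borel" "B \<in> sets borel"
  shows "Lp_norm (A \<times> B) (conj_exponent p) (\<lambda>z. ennreal \<bar>inverse (w z)\<bar>)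
    = ennreal_pow (dual_mass p u1 A * dual_mass p u2 B) (1 / conj_exponent p)"
proof -
  have "(\<integral>\<^sup>+z\<in>A \<times> B. ennreal_pow (ennreal \<bar>inverse (w z)\<bar>) (conj_exponent p) \<partial>lebesgue)
      = (\<integral>\<^sup>+z\<in>A \<times> B. ennreal ((u1 (fst z) * u2 (snd z)) powr (- conj_exponent p)) \<partial>lebesgue)"
    unfolding nn_integral_completion
  proof (rule nn_integral_cong_AE)
    show "AE z in lborel. ennreal_pow (ennreal \<bar>inverse (w z)\<bar>) (conj_exponent p) * indicator (A \<times> B) z
      = ennreal ((u1 (fst z) * u2 (snd z)) powr (- conj_exponent p)) * indicator (A \<times> B) z"
      using w_eq
    proof eventually_elim
      case (elim z)
      then show ?case using u_pos(1)[of "fst z"] u_pos(2)[of "snd z"]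
        by (auto simp: ennreal_pow_ennreal powr_mult powr_minus inverse_powr abs_mult)
    qed
  qed
  then show ?thesis unfolding Lp_norm_def dual_mass_rectangle[OF AB] by simp
qed

text \<open>
  A Borel measurable version \<open>H\<close> of \<open>\<bar>f w\<bar>\<close>, to which Tonelli's theorem applies. The right-hand side of
  the last property is the form in which the embedding for rectangles sees the integral of \<open>\<bar>f\<bar>\<close>.
\<close>

lemma ex_borel_representative:
  assumes "(\<lambda>z. f z * w z) \<in> borel_measurable lebesgue"
  obtains H where "H \<in> borel_measurable (lborel \<Otimes>\<^sub>M lborel)"
    "(\<integral>\<^sup>+x. \<integral>\<^sup>+y. ennreal_pow (H (x, y)) p \<partial>lborel \<partial>lborel) = (\<integral>\<^sup>+z. ennreal_pow (ennreal \<bar>f z * w z\<bar>) p \<partial>lebesgue)"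
    "\<And>A B. A \<in> sets borel \<Longrightarrow> B \<in> sets borel \<Longrightarrow> (\<integral>\<^sup>+z\<in>A \<times> B. ennreal \<bar>f z\<bar> \<partial>lebesgue) =
      (\<integral>\<^sup>+x\<in>A. (\<integral>\<^sup>+y\<in>B. H (x, y) * ennreal (1 / u2 y) \<partial>lborel) * ennreal (1 / u1 x) \<partial>lborel)"
proof -
  have "(\<lambda>z. ennreal \<bar>f z * w z\<bar>) \<in> borel_measurable (completion lborel)" using assms by measurable
  then obtain H where H: "H \<in> borel_measurable lborel" "AE z in lborel. ennreal \<bar>f z * w z\<bar> = H z"
    using completion_ex_borel_measurable by blast
  have H'[measurable]: "H \<in> borel_measurable (lborel \<Otimes>\<^sub>M lborel)" using H(1) by (simp only: lborel_prod)
  show thesis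
  proof (rule that[OF H'])
    have "(\<integral>\<^sup>+z. ennreal_pow (ennreal \<bar>f z * w z\<bar>) p \<partial>lebesgue) = (\<integral>\<^sup>+z. ennreal_pow (H z) p \<partial>(lborel \<Otimes>\<^sub>M lborel))"
      unfolding nn_integral_completion lborel_prod
      by (rule nn_integral_cong_AE) (use H(2) in eventually_elim, auto)
    also have "\<dots> = (\<integral>\<^sup>+x. \<integral>\<^sup>+y. ennreal_pow (H (x, y)) p \<partial>lborel \<partial>lborel)"
      by (rule lborel.nn_integral_fst[symmetric]) measurable
    finally show "(\<integral>\<^sup>+x. \<integral>\<^sup>+y. ennreal_pow (H (x, y)) p \<partial>lborel \<partial>lborel) = (\<integral>\<^sup>+z. ennreal_pow (ennreal \<bar>f z * w z\<bar>) p \<partial>lebesgue)" ..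
    fix A B :: "real set" assume [measurable]: "A \<in> sets borel" "B \<in> sets borel"
    have "(\<integral>\<^sup>+z\<in>A \<times> B. ennreal \<bar>f z\<bar> \<partial>lebesgue)
        = (\<integral>\<^sup>+z. (H z * ennreal (1 / u2 (snd z)) * indicator B (snd z)) * (ennreal (1 / u1 (fst z)) * indicator A (fst z)) \<partial>(lborel \<Otimes>\<^sub>M lborel))"
      unfolding nn_integral_completion lborel_prod
    proof (rule nn_integral_cong_AE)
      show "AE z in lborel. ennreal \<bar>f z\<bar> * indicator (A \<times> B) z =
        (H z * ennreal (1 / u2 (snd z)) * indicator B (snd z)) * (ennreal (1 / u1 (fst z)) * indicator A (fst z))"
        using H(2) w_eq
      proof eventually_elim
        case (elim z)
        have "ennreal \<bar>f z\<bar> = ennreal \<bar>f z * w z\<bar> * ennreal (1 / u2 (snd z)) * ennreal (1 / u1 (fst z))"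
          using elim(2) u_pos(1)[of "fst z"] u_pos(2)[of "snd z"]
          by (simp add: ennreal_mult[symmetric] abs_mult)
        then show ?case using elim(1) by (cases z) (auto simp: indicator_def)
      qed
    qed
    also have "\<dots> = (\<integral>\<^sup>+x. \<integral>\<^sup>+y. (H (x, y) * ennreal (1 / u2 y) * indicator B y) * (ennreal (1 / u1 x) * indicator A x) \<partial>lborel \<partial>lborel)"
      by (subst lborel.nn_integral_fst[symmetric]) simp_all
    also have "\<dots> = (\<integral>\<^sup>+x\<in>A. (\<integral>\<^sup>+y\<in>B. H (x, y) * ennreal (1 / u2 y) \<partial>lborel) * ennreal (1 / u1 x) \<partial>lborel)"
      by (intro nn_integral_cong, subst nn_integral_multc) (simp_all add: mult.assoc)
    finally show "(\<integral>\<^sup>+z\<in>A \<times> B. ennreal \<bar>f z\<bar> \<partial>lebesgue) =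
      (\<integral>\<^sup>+x\<in>A. (\<integral>\<^sup>+y\<in>B. H (x, y) * ennreal (1 / u2 y) \<partial>lborel) * ennreal (1 / u1 x) \<partial>lborel)" .
  qed
qed

lemma Hoelder_rectangle:
  assumes f: "(\<lambda>z. f z * w z) \<in> borel_measurable lebesgue"
    and AB: "A \<in> sets borel" "B \<in> sets borel"
    and fin: "dual_mass p u1 A * dual_mass p u2 B < \<infinity>"
  shows "ennreal_pow (\<integral>\<^sup>+z\<in>A \<times> B. ennreal \<bar>f z\<bar> \<partial>lebesgue) p
    \<le> (\<integral>\<^sup>+z. ennreal_pow (ennreal \<bar>f z * w z\<bar>) p \<partial>lebesgue) * ennreal_pow (dual_mass p u1 A * dual_mass p u2 B) (p - 1)"
proof -
  have [measurable]: "(\<lambda>z. u1 (fst z) * u2 (snd z)) \<in> borel_measurable (lebesgue :: (real \<times> real) measure)"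
    by (rule measurable_completion) (simp add: lborel_prod[symmetric])
  have "(\<integral>\<^sup>+z\<in>A \<times> B. ennreal \<bar>f z\<bar> \<partial>lebesgue)
      = (\<integral>\<^sup>+z\<in>A \<times> B. ennreal \<bar>f z * w z\<bar> * ennreal (1 / (u1 (fst z) * u2 (snd z))) \<partial>lebesgue)"
    unfolding nn_integral_completion
  proof (rule nn_integral_cong_AE)
    show "AE z in lborel. ennreal \<bar>f z\<bar> * indicator (A \<times> B) z
      = ennreal \<bar>f z * w z\<bar> * ennreal (1 / (u1 (fst z) * u2 (snd z))) * indicator (A \<times> B) z"
      using w_eq
    proof eventually_elim
      case (elim z)
      then show ?case using u_pos(1)[of "fst z"] u_pos(2)[of "snd z"]
        by (simp add: ennreal_mult[symmetric] abs_mult)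
    qed
  qed
  also have "ennreal_pow \<dots> p \<le> (\<integral>\<^sup>+z\<in>A \<times> B. ennreal_pow (ennreal \<bar>f z * w z\<bar>) p \<partial>lebesgue)
      * ennreal_pow (dual_mass p u1 A * dual_mass p u2 B) (p - 1)"
    unfolding dual_mass_rectangle[OF AB, symmetric]
    by (rule Hoelder_on_set[OF p])
       (use f AB fin u_pos in \<open>simp_all add: dual_mass_rectangle borel_rectangle_lebesgue\<close>)
  also have "\<dots> \<le> (\<integral>\<^sup>+z. ennreal_pow (ennreal \<bar>f z * w z\<bar>) p \<partial>lebesgue)
      * ennreal_pow (dual_mass p u1 A * dual_mass p u2 B) (p - 1)"
    by (intro mult_right_mono nn_integral_mono) (auto simp: indicator_def)
  finally show ?thesis .
qed

end

lemma min_one_le_powr: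
  fixes x a :: real
  assumes "0 < x" "0 < a" "a < 1"
  shows "min 1 x \<le> x powr a"
proof (cases "x \<le> 1")
  case True
  then have "x powr 1 \<le> x powr a" using assms by (intro powr_mono') auto
  then show ?thesis using True assms by simp
next
  case False
  then show ?thesis using assms ge_one_powr_ge_zero[of x a] by simp
qed

text \<open>
  The condition on a single rectangle already forces local integrability of the dual weights: the
  Luxemburg norm is strictly positive, hence the other factor \<open>\<sigma>1(I) * \<sigma>2(J)\<close> is finite, and
  neither factor of this product is \<open>0\<close>.
\<close>

lemma (in product_weight) dual_mass_finite:
  fixes v q :: "real \<times> real \<Rightarrow> real"
  assumes v: "is_weight v" and q: "q \<in> borel_measurable lebesgue" "\<And>z. 1 \<le> q z"
    and \<alpha>: "\<And>x. 0 < \<alpha> x" "\<And>x. \<alpha> x < 1" and \<beta>: "\<And>x. 0 < \<beta> x" "\<And>x. \<beta> x < 1"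
    and fin: "lux_norm (dyad3 k j \<times> dyad3 l m) q
        (\<lambda>(s, t). ennreal \<bar>v (s, t) * (3 * 2 powi k) powr \<alpha> s * (3 * 2 powi l) powr \<beta> t\<bar>)
      * ennreal_pow (dual_mass p u1 (dyad3 k j) * dual_mass p u2 (dyad3 l m)) (1 / conj_exponent p) < \<infinity>"
  shows "dual_mass p u1 (dyad k j) < \<infinity>" "dual_mass p u2 (dyad l m) < \<infinity>"
proof -
  let ?F = "\<lambda>(s, t). ennreal \<bar>v (s, t) * (3 * 2 powi k) powr \<alpha> s * (3 * 2 powi l) powr \<beta> t\<bar>"
  have em: "emeasure lborel (dyad3 i i') = ennreal (3 * 2 powi i)" for i i'
  proof -
    have "2 powi i * (of_int i' - 1) \<le> (2 powi i :: real) * (of_int i' + 2)" by (intro mult_left_mono) auto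
    then show ?thesis by (simp add: dyad3_def algebra_simps)
  qed
  \<comment> \<open>a lower bound for \<open>(3 * 2 powi k) powr \<alpha> * (3 * 2 powi l) powr \<beta>\<close>, uniform in the exponents\<close>
  define c where "c = min 1 (3 * 2 powi k) * min 1 (3 * 2 powi l :: real)"
  have c: "0 < c" by (simp add: c_def)
  have "0 < lux_norm (dyad3 k j \<times> dyad3 l m) q ?F"
  proof (rule lux_norm_pos[OF v q _ _ c])
    show "dyad3 k j \<times> dyad3 l m \<in> sets lebesgue" by (intro borel_rectangle_lebesgue) auto
    have "emeasure lebesgue (dyad3 k j \<times> dyad3 l m) = emeasure (lborel \<Otimes>\<^sub>M lborel) (dyad3 k j \<times> dyad3 l m)"
      unfolding lborel_prod by (subst emeasure_completion) (auto simp: lborel_prod[symmetric])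
    also have "\<dots> \<noteq> 0" by (subst lborel.emeasure_pair_measure_Times) (simp_all add: em ennreal_eq_0_iff not_le)
    finally show "emeasure lebesgue (dyad3 k j \<times> dyad3 l m) \<noteq> 0" .
    fix z :: "real \<times> real"
    have "c * \<bar>v z\<bar> \<le> ((3 * 2 powi k) powr \<alpha> (fst z) * (3 * 2 powi l) powr \<beta> (snd z)) * \<bar>v z\<bar>"
      unfolding c_def by (intro mult_right_mono mult_mono min_one_le_powr) (auto simp: \<alpha> \<beta>)
    then show "ennreal (c * \<bar>v z\<bar>) \<le> ?F z"
      by (cases z) (auto simp: abs_mult mult_ac intro!: ennreal_leI)
  qed
  then have "dual_mass p u1 (dyad3 k j) * dual_mass p u2 (dyad3 l m) \<noteq> top"
    using fin by (auto simp: ennreal_mult_top split: if_splits)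
  moreover have "dual_mass p u1 (dyad3 k j) \<noteq> 0" "dual_mass p u2 (dyad3 l m) \<noteq> 0"
    using dual_mass_pos[of u1 "dyad3 k j" p] dual_mass_pos[of u2 "dyad3 l m" p] u_pos
    by (auto simp: em ennreal_eq_0_iff not_le)
  ultimately have "dual_mass p u1 (dyad3 k j) < top" "dual_mass p u2 (dyad3 l m) < top"
    by (auto simp: ennreal_mult_eq_top_iff less_top[symmetric])
  moreover have "dual_mass p u (dyad i i') \<le> dual_mass p u (dyad3 i i')" for u i i'
    unfolding dual_mass_def by (intro nn_integral_mono) (use dyad_subset_dyad3 in \<open>auto simp: indicator_def\<close>)
  ultimately show "dual_mass p u1 (dyad k j) < \<infinity>" "dual_mass p u2 (dyad l m) < \<infinity>"
    by (auto intro: le_less_trans)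
qed

section \<open>Sufficiency of the condition\<close>

text \<open>
  The embedding \<open>emb\<close> for the exponent \<open>r\<close> and the condition on the triples of dyadic rectangles imply
  the norm inequality. The Luxemburg norm is estimated by showing that the modular of
  \<open>M f \<cdot> v / \<Lambda>\<close> is at most \<open>1\<close>: at \<open>z\<close> this function is at most the supremum of \<open>t\<^sub>R \<phi>\<^sub>R(z)\<close> over the
  dyadic rectangles \<open>R\<close> whose triple contains \<open>z\<close>.
\<close>

lemma (in product_weight) strong_frac_max_norm_bound:
  fixes f v q :: "real \<times> real \<Rightarrow> real" and \<alpha> \<beta> :: "real \<Rightarrow> real" and A K r T :: real
  defines "\<sigma>1 \<equiv> \<lambda>k j. enn2real (dual_mass p u1 (dyad k j))"
    and "\<sigma>2 \<equiv> \<lambda>l m. enn2real (dual_mass p u2 (dyad l m))"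
  assumes K: "0 < K" and emb: "\<And>H T.
      \<lbrakk>H \<in> borel_measurable (lborel \<Otimes>\<^sub>M lborel); 0 \<le> T; (\<integral>\<^sup>+x. \<integral>\<^sup>+y. ennreal_pow (H (x, y)) p \<partial>lborel \<partial>lborel) \<le> ennreal T\<rbrakk> \<Longrightarrow>
      (\<integral>\<^sup>+(l, m). \<integral>\<^sup>+(k, j). ennreal_pow (ennreal_pow (\<integral>\<^sup>+x\<in>dyad k j. (\<integral>\<^sup>+y\<in>dyad l m. H (x, y) * ennreal (1 / u2 y) \<partial>lborel) * ennreal (1 / u1 x) \<partial>lborel) p
          * ennreal ((\<sigma>1 k j * \<sigma>2 l m) powr (1 - p))) (r / p)
        \<partial>count_space UNIV \<partial>count_space UNIV) \<le> ennreal (K * T powr (r / p))"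
    and r: "p < r" "\<And>z. r \<le> q z" and q[measurable]: "q \<in> borel_measurable lebesgue"
    and \<alpha>[measurable]: "\<alpha> \<in> borel_measurable lebesgue" and \<alpha>': "\<And>x. 0 < \<alpha> x" "\<And>x. \<alpha> x < 1"
    and \<beta>[measurable]: "\<beta> \<in> borel_measurable lebesgue" and \<beta>': "\<And>x. 0 < \<beta> x" "\<And>x. \<beta> x < 1"
    and v[measurable]: "v \<in> borel_measurable lebesgue"
    and fin: "\<And>k j. dual_mass p u1 (dyad k j) < \<infinity>" "\<And>k j. dual_mass p u2 (dyad k j) < \<infinity>"
    and pos: "\<And>k j. 0 < dual_mass p u1 (dyad k j)" "\<And>k j. 0 < dual_mass p u2 (dyad k j)"
    and A: "0 < A" and hyp: "\<And>k j l m. lux_norm (dyad3 k j \<times> dyad3 l m) q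
        (\<lambda>(s, t). ennreal \<bar>v (s, t) * (3 * 2 powi k) powr \<alpha> s * (3 * 2 powi l) powr \<beta> t\<bar>)
      * ennreal_pow (dual_mass p u1 (dyad3 k j) * dual_mass p u2 (dyad3 l m)) (1 / conj_exponent p)
      < ennreal (A * (9 * 2 powi k * 2 powi l))"
    and f[measurable]: "f \<in> borel_measurable lebesgue" and w[measurable]: "w \<in> borel_measurable lebesgue"
    and T: "0 < T" "(\<integral>\<^sup>+z. ennreal_pow (ennreal \<bar>f z * w z\<bar>) p \<partial>lebesgue) \<le> ennreal (T powr p)"
  shows "lux_norm UNIV q (\<lambda>z. strong_frac_max \<alpha> \<beta> f z * ennreal \<bar>v z\<bar>) \<le> ennreal (324 * A * (1 + K) * T)"
proof -
  let ?p' = "conj_exponent p"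
  define \<Lambda> where "\<Lambda> = 324 * A * (1 + K) * T"
  have \<Lambda>: "0 < \<Lambda>" using A K T by (simp add: \<Lambda>_def)
  have p'_inv: "1 / ?p' = (p - 1) / p" using p by (simp add: conj_exponent_def)
  have \<sigma>: "dual_mass p u1 (dyad k j) = ennreal (\<sigma>1 k j)" "0 < \<sigma>1 k j"
    "dual_mass p u2 (dyad k j) = ennreal (\<sigma>2 k j)" "0 < \<sigma>2 k j" for k j
    using fin[of k j] pos[of k j] by (auto simp: \<sigma>1_def \<sigma>2_def enn2real_positive_iff)
  define D where "D k j l m = \<sigma>1 k j * \<sigma>2 l m" for k j l m
  have D: "0 < D k j l m" "dual_mass p u1 (dyad k j) * dual_mass p u2 (dyad l m) = ennreal (D k j l m)" for k j l m
    using \<sigma> by (simp_all add: D_def ennreal_mult less_imp_le)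
  define \<omega> where "\<omega> k j l m = D k j l m powr (1 / ?p')" for k j l m
  have \<omega>: "0 < \<omega> k j l m" for k j l m using D(1)[of k j l m] by (simp add: \<omega>_def)
  \<comment> \<open>the hypothesis bounds the norm of the numerator of \<open>\<phi>\<close> strictly by \<open>L\<close>\<close>
  define L where "L k j l m = A * (9 * 2 powi k * 2 powi l) / \<omega> k j l m" for k j l m
  have L: "0 < L k j l m" for k j l m using A \<omega>[of k j l m] by (simp add: L_def)
  define a where "a k j l m = (\<integral>\<^sup>+z\<in>dyad k j \<times> dyad l m. ennreal \<bar>f z\<bar> \<partial>lebesgue)" for k j l m
  define \<phi> where "\<phi> k j l m z = ennreal (\<bar>v z\<bar> * (2 powi k) powr \<alpha> (fst z) * (2 powi l) powr \<beta> (snd z)) / ennreal (L k j l m)" for k j l m z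
  \<comment> \<open>\<open>324 = 36 * 9\<close>: \<open>36\<close> from the domination by dyadic averages, \<open>9\<close> from \<open>\<bar>3R\<bar> = 9 \<bar>R\<bar>\<close>\<close>
  define t where "t k j l m = ennreal (324 * A / (\<Lambda> * \<omega> k j l m)) * a k j l m" for k j l m
  have fw[measurable]: "(\<lambda>z. f z * w z) \<in> borel_measurable lebesgue" by measurable
  have meas_\<alpha>[measurable]: "(\<lambda>z. \<alpha> (fst z)) \<in> borel_measurable (lebesgue :: (real \<times> real) measure)"
    using measurable_compose[OF measurable_fst_lebesgue \<alpha>] .
  have meas_\<beta>[measurable]: "(\<lambda>z. \<beta> (snd z)) \<in> borel_measurable (lebesgue :: (real \<times> real) measure)"
    using measurable_compose[OF measurable_snd_lebesgue \<beta>] .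
  have [measurable]: "\<phi> k j l m \<in> borel_measurable lebesgue" for k j l m
    unfolding \<phi>_def by measurable
  have q0: "0 < q z" "1 \<le> q z" for z using p r(1) r(2)[of z] by auto

  have modular: "(\<integral>\<^sup>+z\<in>dyad3 k j \<times> dyad3 l m. ennreal_pow (\<phi> k j l m z) (q z) \<partial>lebesgue) \<le> 1" for k j l m
  proof -
    let ?F = "\<lambda>(s, t). ennreal \<bar>v (s, t) * (3 * 2 powi k) powr \<alpha> s * (3 * 2 powi l) powr \<beta> t\<bar>"
    have "dual_mass p u1 (dyad k j) * dual_mass p u2 (dyad l m)
        \<le> dual_mass p u1 (dyad3 k j) * dual_mass p u2 (dyad3 l m)"
      unfolding dual_mass_def by (intro mult_mono nn_integral_mono) (use dyad_subset_dyad3 in \<open>auto simp: indicator_def\<close>)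
    then have \<omega>_le: "ennreal (\<omega> k j l m) \<le> ennreal_pow (dual_mass p u1 (dyad3 k j) * dual_mass p u2 (dyad3 l m)) (1 / ?p')"
      using ennreal_pow_mono[of "1 / ?p'"] conj_exponent_pos D(1)[of k j l m]
      unfolding D(2) by (simp add: \<omega>_def ennreal_pow_ennreal[symmetric] less_imp_le)
    have "lux_norm (dyad3 k j \<times> dyad3 l m) q ?F < ennreal (L k j l m)"
    proof (rule ccontr)
      assume "\<not> ?thesis"
      then have "ennreal (L k j l m) * ennreal (\<omega> k j l m) \<le> lux_norm (dyad3 k j \<times> dyad3 l m) q ?F
          * ennreal_pow (dual_mass p u1 (dyad3 k j) * dual_mass p u2 (dyad3 l m)) (1 / ?p')"
        by (intro mult_mono \<omega>_le) auto
      also have "\<dots> < ennreal (A * (9 * 2 powi k * 2 powi l))" by (rule hyp)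
      also have "\<dots> = ennreal (L k j l m) * ennreal (\<omega> k j l m)"
        using L[of k j l m] \<omega>[of k j l m] by (simp add: ennreal_mult[symmetric] L_def)
      finally show False by simp
    qed
    then show ?thesis
      unfolding \<phi>_def
    proof (rule modular_le_one_of_lux_norm_less)
      show "0 \<le> q z" for z using q0[of z] by simp
      fix z :: "real \<times> real"
      have mono: "(2 powi i) powr c \<le> (3 * 2 powi i :: real) powr c" if "0 < c" for i c
        using that by (intro powr_mono2) auto
      have "\<bar>v z\<bar> * (2 powi k) powr \<alpha> (fst z) * (2 powi l) powr \<beta> (snd z)
          \<le> \<bar>v z\<bar> * (3 * 2 powi k) powr \<alpha> (fst z) * (3 * 2 powi l) powr \<beta> (snd z)"
        by (intro mult_mono mono \<alpha>' \<beta>') auto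
      then show "ennreal (\<bar>v z\<bar> * (2 powi k) powr \<alpha> (fst z) * (2 powi l) powr \<beta> (snd z)) \<le> ?F z"
        by (cases z) (auto simp: abs_mult intro!: ennreal_leI)
    qed
  qed

  have a_pow: "ennreal_pow (a k j l m) p \<le> ennreal (T powr p * D k j l m powr (p - 1))" for k j l m
  proof -
    have "ennreal_pow (a k j l m) p \<le> (\<integral>\<^sup>+z. ennreal_pow (ennreal \<bar>f z * w z\<bar>) p \<partial>lebesgue) * ennreal_pow (ennreal (D k j l m)) (p - 1)"
      using Hoelder_rectangle[OF fw, of "dyad k j" "dyad l m"] unfolding a_def D(2) by simp
    also have "\<dots> \<le> ennreal (T powr p) * ennreal_pow (ennreal (D k j l m)) (p - 1)"
      using T(2) by (intro mult_right_mono) auto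
    also have "\<dots> = ennreal (T powr p * D k j l m powr (p - 1))"
      using D(1)[of k j l m] by (simp add: ennreal_pow_ennreal ennreal_mult less_imp_le)
    finally show ?thesis .
  qed
  have a_le: "a k j l m \<le> ennreal (T * \<omega> k j l m)" for k j l m
  proof -
    have "a k j l m \<le> ennreal_pow (ennreal (T powr p * D k j l m powr (p - 1))) (1 / p)"
      using a_pow[of k j l m] p by (subst (asm) ennreal_pow_inverse_le_iff) auto
    also have "\<dots> = ennreal (T * \<omega> k j l m)"
      using p T(1) D(1)[of k j l m] by (simp add: ennreal_pow_ennreal powr_mult powr_powr \<omega>_def p'_inv)
    finally show ?thesis .
  qed
  have t_le_1: "t k j l m \<le> 1" for k j l m
  proof -
    have "t k j l m \<le> ennreal (324 * A / (\<Lambda> * \<omega> k j l m)) * ennreal (T * \<omega> k j l m)"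
      unfolding t_def by (intro mult_left_mono a_le) auto
    also have "\<dots> = ennreal (1 / (1 + K))"
      using \<omega>[of k j l m] A K T(1) \<Lambda> by (simp add: ennreal_mult[symmetric] \<Lambda>_def)
    also have "\<dots> \<le> 1" using K by (simp add: ennreal_le_1)
    finally show ?thesis .
  qed
  have t_pow: "ennreal_pow (t k j l m) r = ennreal ((324 * A / \<Lambda>) powr r)
      * ennreal_pow (ennreal_pow (a k j l m) p * ennreal (D k j l m powr (1 - p))) (r / p)" for k j l m
  proof -
    have 1: "(324 * A / (\<Lambda> * \<omega> k j l m)) powr r = (324 * A / \<Lambda>) powr r * D k j l m powr ((1 - p) * (r / p))"
    proof -
      have "(324 * A / (\<Lambda> * \<omega> k j l m)) powr r = (324 * A / \<Lambda>) powr r * \<omega> k j l m powr (- r)"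
        using A \<Lambda> \<omega>[of k j l m] by (simp add: powr_divide powr_mult powr_minus field_simps)
      also have "\<omega> k j l m powr (- r) = D k j l m powr ((1 - p) * (r / p))"
        using p by (simp add: \<omega>_def powr_powr p'_inv field_simps)
      finally show ?thesis .
    qed
    have "ennreal_pow (t k j l m) r = ennreal ((324 * A / (\<Lambda> * \<omega> k j l m)) powr r) * ennreal_pow (a k j l m) r"
      using A \<Lambda> \<omega>[of k j l m] by (simp add: t_def ennreal_pow_mult ennreal_pow_ennreal)
    also have "ennreal_pow (a k j l m) r = ennreal_pow (ennreal_pow (a k j l m) p) (r / p)"
      using p by (simp add: ennreal_pow_pow)
    finally show ?thesis
      unfolding 1 by (simp add: ennreal_pow_mult ennreal_pow_ennreal powr_powr ennreal_mult mult_ac)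
  qed

  \<comment> \<open>the sum over all dyadic rectangles that replaces the supremum\<close>
  define S where "S z = (\<integral>\<^sup>+((l, m), (k, j)). ennreal_pow (t k j l m) r
      * (ennreal_pow (\<phi> k j l m z) (q z) * indicator (dyad3 k j \<times> dyad3 l m) z) \<partial>count_space UNIV)" for z
  have pointwise: "ennreal_pow (strong_frac_max \<alpha> \<beta> f z * ennreal \<bar>v z\<bar> / ennreal \<Lambda>) (q z) \<le> S z" for z
  proof (cases "v z = 0")
    case False
    obtain x y where z: "z = (x, y)" by (cases z)
    \<comment> \<open>chosen so that \<open>36 * B * \<bar>v z\<bar> / \<Lambda>\<close> equals \<open>S z\<close> to the power \<open>1 / q z\<close>\<close>
    define B where "B = ennreal (\<Lambda> / (36 * \<bar>v z\<bar>)) * ennreal_pow (S z) (1 / q z)"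
    have "strong_frac_max \<alpha> \<beta> f (x, y) \<le> 36 * B"
    proof (rule strong_frac_max_dyadic_bound[where \<alpha> = \<alpha> and \<beta> = \<beta> and x = x and y = y, OF f \<alpha>' \<beta>'])
      fix k j l m assume mem: "x \<in> dyad3 k j" "y \<in> dyad3 l m"
      define W where "W = (2 powi k) powr (\<alpha> x - 1) * (2 powi l) powr (\<beta> y - 1)"
      have W: "0 < W" by (simp add: W_def)
      have "ennreal_pow (t k j l m * \<phi> k j l m z) (q z) \<le> ennreal_pow (t k j l m) r * ennreal_pow (\<phi> k j l m z) (q z)"
        unfolding ennreal_pow_mult by (intro mult_right_mono ennreal_pow_antimono_exponent t_le_1 r(2)) simp
      also have "\<dots> \<le> S z"
        using nn_integral_count_space_ge_point[of "\<lambda>((l, m), (k, j)). ennreal_pow (t k j l m) r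
          * (ennreal_pow (\<phi> k j l m z) (q z) * indicator (dyad3 k j \<times> dyad3 l m) z)" "((l, m), (k, j))"] mem
        by (simp add: S_def z)
      finally have tphi: "t k j l m * \<phi> k j l m z \<le> ennreal_pow (S z) (1 / q z)"
        using q0[of z] by (simp add: ennreal_pow_inverse_le_iff)
      have split: "(2 powi k) powr \<alpha> x * (2 powi l) powr \<beta> y = 2 powi k * 2 powi l * W"
        by (simp add: W_def powr_diff)
      have collect: "ennreal c1 * (ennreal c2 * X * ennreal c3) = ennreal (c1 * c2 * c3) * X"
        if "0 \<le> c1" "0 \<le> c2" "0 \<le> c3" for c1 c2 c3 X
        using that by (simp add: ennreal_mult mult_ac)
      have "ennreal W * a k j l m = ennreal (\<Lambda> / (36 * \<bar>v z\<bar>)) * (t k j l m * \<phi> k j l m z)"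
      proof -
        have "\<phi> k j l m z = ennreal (\<bar>v z\<bar> * (2 powi k * 2 powi l * W) / L k j l m)"
          using L[of k j l m] W unfolding \<phi>_def z fst_conv snd_conv mult.assoc split by (subst divide_ennreal) auto
        then have "ennreal (\<Lambda> / (36 * \<bar>v z\<bar>)) * (t k j l m * \<phi> k j l m z)
            = ennreal (\<Lambda> / (36 * \<bar>v z\<bar>) * (324 * A / (\<Lambda> * \<omega> k j l m)) * (\<bar>v z\<bar> * (2 powi k * 2 powi l * W) / L k j l m)) * a k j l m"
          unfolding t_def using L[of k j l m] W \<Lambda> A \<omega>[of k j l m] by (simp only:) (rule collect; simp)
        also have "\<Lambda> / (36 * \<bar>v z\<bar>) * (324 * A / (\<Lambda> * \<omega> k j l m)) * (\<bar>v z\<bar> * (2 powi k * 2 powi l * W) / L k j l m) = W"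
          using False A \<Lambda> \<omega>[of k j l m] by (simp add: L_def field_simps)
        finally show ?thesis by simp
      qed
      also have "\<dots> \<le> B" unfolding B_def by (intro mult_left_mono tphi) simp
      finally show "ennreal ((2 powi k) powr (\<alpha> x - 1) * (2 powi l) powr (\<beta> y - 1)) * (\<integral>\<^sup>+u\<in>dyad k j \<times> dyad l m. ennreal \<bar>f u\<bar> \<partial>lebesgue) \<le> B"
        unfolding W_def a_def .
    qed
    then have "strong_frac_max \<alpha> \<beta> f z * ennreal \<bar>v z\<bar> / ennreal \<Lambda> \<le> 36 * B * ennreal \<bar>v z\<bar> / ennreal \<Lambda>"
      unfolding z by (intro divide_right_mono_ennreal mult_right_mono) auto
    also have "\<dots> = ennreal (36 * (\<Lambda> / (36 * \<bar>v z\<bar>)) * \<bar>v z\<bar> * inverse \<Lambda>) * ennreal_pow (S z) (1 / q z)"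
    proof -
      have "36 * (ennreal c1 * X) * ennreal c2 * ennreal c3 = ennreal (36 * c1 * c2 * c3) * X"
        if "0 \<le> c1" "0 \<le> c2" "0 \<le> c3" for c1 c2 c3 X
        using that by (simp add: ennreal_mult mult_ac)
      then show ?thesis
        using \<Lambda> unfolding B_def divide_ennreal_def by (simp only: inverse_ennreal) simp
    qed
    also have "36 * (\<Lambda> / (36 * \<bar>v z\<bar>)) * \<bar>v z\<bar> * inverse \<Lambda> = 1"
      using False \<Lambda> by simp
    finally show ?thesis using q0[of z] by (simp add: ennreal_pow_inverse_le_iff)
  qed simp

  obtain H where H: "H \<in> borel_measurable (lborel \<Otimes>\<^sub>M lborel)"
    "(\<integral>\<^sup>+x. \<integral>\<^sup>+y. ennreal_pow (H (x, y)) p \<partial>lborel \<partial>lborel) = (\<integral>\<^sup>+z. ennreal_pow (ennreal \<bar>f z * w z\<bar>) p \<partial>lebesgue)"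
    "\<And>A B. A \<in> sets borel \<Longrightarrow> B \<in> sets borel \<Longrightarrow> (\<integral>\<^sup>+z\<in>A \<times> B. ennreal \<bar>f z\<bar> \<partial>lebesgue) =
      (\<integral>\<^sup>+x\<in>A. (\<integral>\<^sup>+y\<in>B. H (x, y) * ennreal (1 / u2 y) \<partial>lborel) * ennreal (1 / u1 x) \<partial>lborel)"
    by (rule ex_borel_representative[OF fw]) blast

  have "(\<integral>\<^sup>+z\<in>UNIV. ennreal_pow (strong_frac_max \<alpha> \<beta> f z * ennreal \<bar>v z\<bar> / ennreal \<Lambda>) (q z) \<partial>lebesgue) \<le> (\<integral>\<^sup>+z. S z \<partial>lebesgue)"
    by (intro nn_integral_mono) (simp add: pointwise)
  also have "\<dots> = (\<integral>\<^sup>+((l, m), (k, j)). ennreal_pow (t k j l m) r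
      * (\<integral>\<^sup>+z\<in>dyad3 k j \<times> dyad3 l m. ennreal_pow (\<phi> k j l m z) (q z) \<partial>lebesgue) \<partial>count_space UNIV)"
    unfolding S_def by (subst nn_integral_count_space_nn_integral) (auto simp: split_beta' nn_integral_cmult)
  also have "\<dots> \<le> (\<integral>\<^sup>+((l, m), (k, j)). ennreal_pow (t k j l m) r \<partial>count_space UNIV)"
    by (intro nn_integral_mono) (use mult_left_mono[OF modular] in \<open>auto simp: split_beta\<close>)
  also have "\<dots> = (\<integral>\<^sup>+(l, m). \<integral>\<^sup>+(k, j). ennreal_pow (t k j l m) r \<partial>count_space UNIV \<partial>count_space UNIV)"
    by (subst nn_integral_fst_count_space[symmetric]) (simp add: split_beta')
  also have "\<dots> = ennreal ((324 * A / \<Lambda>) powr r) * (\<integral>\<^sup>+(l, m). \<integral>\<^sup>+(k, j).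
      ennreal_pow (ennreal_pow (a k j l m) p * ennreal (D k j l m powr (1 - p))) (r / p) \<partial>count_space UNIV \<partial>count_space UNIV)"
    unfolding t_pow by (simp add: split_beta' nn_integral_cmult)
  also have "\<dots> \<le> ennreal ((324 * A / \<Lambda>) powr r) * ennreal (K * (T powr p) powr (r / p))"
    using emb[OF H(1), of "T powr p"] T(2) unfolding H(2) a_def D_def
    by (intro mult_left_mono) (auto simp: H(3))
  also have "\<dots> = ennreal ((324 * A * T / \<Lambda>) powr r * K)"
    using A T(1) \<Lambda> K p by (simp add: ennreal_mult[symmetric] powr_powr powr_mult powr_divide mult_ac)
  also have "324 * A * T / \<Lambda> = 1 / (1 + K)" using A T K by (simp add: \<Lambda>_def)
  also have "ennreal ((1 / (1 + K)) powr r * K) \<le> 1"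
  proof -
    \<comment> \<open>here \<open>r \<ge> 1\<close> compensates the constant \<open>K\<close> of the embedding\<close>
    have "(1 / (1 + K)) powr r \<le> (1 / (1 + K)) powr 1" using K p r(1) by (intro powr_mono') auto
    then have "(1 / (1 + K)) powr r * K \<le> 1 / (1 + K) * K" using K by (intro mult_right_mono) auto
    also have "\<dots> \<le> 1" using K by simp
    finally show ?thesis by (simp add: ennreal_le_1)
  qed
  finally have "(\<integral>\<^sup>+z\<in>UNIV. ennreal_pow (strong_frac_max \<alpha> \<beta> f z * ennreal \<bar>v z\<bar> / ennreal \<Lambda>) (q z) \<partial>lebesgue) \<le> 1" .
  then show ?thesis
    unfolding \<Lambda>_def[symmetric] by (rule lux_norm_le[OF \<Lambda>])
qed

section \<open>Necessity of the condition\<close>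

lemma bounded_intervals_lmeasurable:
  assumes "I \<in> bounded_intervals" "J \<in> bounded_intervals"
  shows "I \<times> J \<in> lmeasurable"
proof (rule measurable_convex)
  show "convex (I \<times> J)"
    by (rule convex_Times) (use assms in \<open>auto simp: bounded_intervals_def is_interval_convex\<close>)
  show "bounded (I \<times> J)"
    by (rule bounded_Times) (use assms in \<open>auto simp: bounded_intervals_def\<close>)
qed

text \<open>
  The test function is \<open>f = (1 / \<bar>w\<bar>) powr p'\<close> on \<open>I \<times> J\<close>, cut off where \<open>1 / \<bar>w\<bar> > n\<close>. With \<open>x\<close> the
  integral of \<open>f\<close>, the inequality reads \<open>x * Y \<le> c * x powr (1 / p)\<close>, that is \<open>Y * x powr (1 / p') \<le> c\<close>. The
  cut-off makes \<open>x\<close> finite, which is needed for the division; monotone convergence removes it.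
\<close>

lemma weighted_test_condition:
  fixes w q v :: "real \<times> real \<Rightarrow> real"
  assumes p: "1 < p" and w[measurable]: "w \<in> borel_measurable lebesgue" and q: "\<And>z. 0 \<le> q z"
    and c: "0 < c" "\<And>f. f \<in> weighted_Lp p w \<Longrightarrow>
      lux_norm UNIV q (\<lambda>z. strong_frac_max \<alpha> \<beta> f z * ennreal \<bar>v z\<bar>) \<le> ennreal c * Lp_norm UNIV p (\<lambda>z. ennreal \<bar>f z * w z\<bar>)"
    and IJ: "I \<in> bounded_intervals" "J \<in> bounded_intervals"
  shows "ennreal (inverse (measure lebesgue I * measure lebesgue J))
        * lux_norm (I \<times> J) q (\<lambda>(s, t). ennreal \<bar>v (s, t) * measure lebesgue I powr \<alpha> s * measure lebesgue J powr \<beta> t\<bar>)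
        * Lp_norm (I \<times> J) (conj_exponent p) (\<lambda>z. ennreal \<bar>inverse (w z)\<bar>) \<le> ennreal c"
proof -
  let ?p' = "conj_exponent p" and ?E = "I \<times> J"
  let ?F = "\<lambda>(s, t). ennreal \<bar>v (s, t) * measure lebesgue I powr \<alpha> s * measure lebesgue J powr \<beta> t\<bar>"
  define a b where "a = measure lebesgue I" and "b = measure lebesgue J"
  have ab: "0 < a" "0 < b" using IJ by (auto simp: bounded_intervals_def a_def b_def)
  have p': "0 < ?p'" "(?p' - 1) * p = ?p'" "1 / p + 1 / ?p' = 1"
    using p by (auto simp: conj_exponent_def field_simps)
  have E: "?E \<in> lmeasurable" by (rule bounded_intervals_lmeasurable[OF IJ])
  then have [measurable]: "?E \<in> sets lebesgue" and Efin: "emeasure lebesgue ?E < \<infinity>" by (auto simp: fmeasurable_def)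
  define g where "g z = \<bar>inverse (w z)\<bar>" for z
  have g[measurable]: "g \<in> borel_measurable lebesgue" unfolding g_def by measurable
  define G where "G n z = (ennreal (g z powr ?p') * indicator {z. g z \<le> real n} z) * indicator ?E z" for n z
  define X where "X n = (\<integral>\<^sup>+z. G n z \<partial>lebesgue)" for n
  have G[measurable]: "G n \<in> borel_measurable lebesgue" for n
    unfolding G_def by measurable
  define Y where "Y = ennreal (inverse (a * b)) * lux_norm ?E q ?F"
  have test: "Y * ennreal_pow (X n) (1 / ?p') \<le> ennreal c" for n
  proof -
    define f where "f z = (g z powr ?p' * indicator {z. g z \<le> real n} z) * indicator ?E z" for z
    have [measurable]: "f \<in> borel_measurable lebesgue" unfolding f_def by measurable
    have f_G: "ennreal \<bar>f z\<bar> = G n z" "ennreal \<bar>f z\<bar> * indicator ?E z = G n z" for z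
      by (auto simp: f_def G_def indicator_def)
    \<comment> \<open>\<open>(g powr p' / g) powr p = g powr p'\<close> because \<open>(p' - 1) * p = p'\<close>\<close>
    have fw_G: "ennreal_pow (ennreal \<bar>f z * w z\<bar>) p = G n z" for z
    proof (cases "w z = 0 \<or> f z = 0")
      case True
      then show ?thesis using p' by (auto simp: f_def G_def g_def indicator_def ennreal_pow_ennreal split: if_splits)
    next
      case False
      then have "g z \<le> real n" "z \<in> ?E" by (auto simp: f_def indicator_def split: if_splits)
      with False have gz: "0 < g z" and f: "f z = g z powr ?p'" and w: "\<bar>w z\<bar> = g z powr (- 1)"
        by (auto simp: g_def f_def powr_minus)
      have "\<bar>f z * w z\<bar> = g z powr (?p' - 1)"
        unfolding abs_mult f w using gz by (simp add: powr_diff powr_minus divide_inverse)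
      then have "\<bar>f z * w z\<bar> powr p = g z powr ?p'" by (simp add: powr_powr p')
      moreover have "G n z = ennreal (g z powr ?p')"
        using False by (auto simp: f_def G_def indicator_def split: if_splits)
      ultimately show ?thesis by (simp add: ennreal_pow_ennreal)
    qed
    have "X n \<le> (\<integral>\<^sup>+z. ennreal (real n powr ?p') * indicator ?E z \<partial>lebesgue)"
      unfolding X_def G_def
      by (intro nn_integral_mono) (use p' in \<open>auto simp: indicator_def g_def intro!: ennreal_leI powr_mono2\<close>)
    also have "\<dots> < \<infinity>" using Efin by (subst nn_integral_cmult_indicator) (auto simp: ennreal_mult_less_top)
    finally have "X n < \<infinity>" .
    then obtain x where x: "X n = ennreal x" "0 \<le> x" by (cases "X n") auto
    have Lp: "Lp_norm UNIV p (\<lambda>z. ennreal \<bar>f z * w z\<bar>) = ennreal (x powr (1 / p))"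
      using x by (simp add: Lp_norm_def fw_G X_def[symmetric] ennreal_pow_ennreal)
    then have "f \<in> weighted_Lp p w" by (simp add: weighted_Lp_def)
    note bound = c(2)[OF this]
    show ?thesis
    proof (cases "x = 0")
      case False
      then have x0: "0 < x" using x by simp
      have "ennreal (x * inverse (a * b)) * lux_norm ?E q ?F
          \<le> lux_norm UNIV q (\<lambda>z. strong_frac_max \<alpha> \<beta> f z * ennreal \<bar>v z\<bar>)"
      proof (rule lux_norm_scale_le)
        show "0 < x * inverse (a * b)" using x0 ab by simp
        fix z assume z: "z \<in> ?E"
        obtain s t where st: "z = (s, t)" by (cases z)
        have "ennreal (a powr (\<alpha> s - 1) * b powr (\<beta> t - 1)) * (\<integral>\<^sup>+u\<in>?E. ennreal \<bar>f u\<bar> \<partial>lebesgue)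
            \<le> strong_frac_max \<alpha> \<beta> f (s, t)"
          unfolding strong_frac_max_def prod.case a_def b_def
          by (rule order_trans[OF _ SUP_upper[of I]], rule order_trans[OF _ SUP_upper[of J]])
             (use IJ z st in auto)
        also have "(\<integral>\<^sup>+u\<in>?E. ennreal \<bar>f u\<bar> \<partial>lebesgue) = ennreal x"
          unfolding x(1)[symmetric] X_def by (simp only: f_G(2))
        finally have M: "ennreal (a powr (\<alpha> s - 1) * b powr (\<beta> t - 1)) * ennreal x \<le> strong_frac_max \<alpha> \<beta> f z"
          unfolding st .
        have "x * inverse (a * b) * \<bar>v (s, t) * a powr \<alpha> s * b powr \<beta> t\<bar>
            = (a powr (\<alpha> s - 1) * b powr (\<beta> t - 1)) * x * \<bar>v (s, t)\<bar>"
          using ab by (simp add: abs_mult powr_diff field_simps)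
        then have "ennreal (x * inverse (a * b)) * ?F z
            = ennreal (a powr (\<alpha> s - 1) * b powr (\<beta> t - 1)) * ennreal x * ennreal \<bar>v z\<bar>"
          using x0 ab unfolding st a_def[symmetric] b_def[symmetric] by (simp add: ennreal_mult[symmetric])
        also have "\<dots> \<le> strong_frac_max \<alpha> \<beta> f z * ennreal \<bar>v z\<bar>"
          by (intro mult_right_mono M) simp
        finally show "ennreal (x * inverse (a * b)) * ?F z \<le> strong_frac_max \<alpha> \<beta> f z * ennreal \<bar>v z\<bar>" .
      qed (rule q)
      also have "\<dots> \<le> ennreal c * ennreal (x powr (1 / p))" using bound Lp by simp
      finally have "ennreal x * Y \<le> ennreal (c * x powr (1 / p))"
        using x0 ab c by (simp add: Y_def ennreal_mult mult.assoc)
      then have "ennreal (x powr (- (1 / p))) * (ennreal x * Y) \<le> ennreal (x powr (- (1 / p))) * ennreal (c * x powr (1 / p))"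
        by (rule mult_left_mono) simp
      moreover have "ennreal (x powr (- (1 / p))) * ennreal (c * x powr (1 / p)) = ennreal c"
        using x0 c by (simp add: ennreal_mult[symmetric] powr_minus field_simps)
      moreover have "ennreal (x powr (- (1 / p))) * (ennreal x * Y) = Y * ennreal (x powr (1 / ?p'))"
      proof -
        have "x powr (1 / p) * x powr (1 / ?p') = x"
          unfolding powr_add[symmetric] p'(3) using x0 by simp
        then have "x powr (1 / ?p') = x powr (- (1 / p)) * x"
          using x0 by (simp add: powr_minus field_simps)
        then show ?thesis using x0 by (simp add: ennreal_mult mult_ac)
      qed
      ultimately show ?thesis using x by (simp add: ennreal_pow_ennreal)
    qed (simp add: x)
  qed
  have mono: "incseq G"
    by (auto simp: incseq_def le_fun_def G_def indicator_def)
  have sup: "(SUP n. G n z) = ennreal_pow (ennreal \<bar>inverse (w z)\<bar>) ?p' * indicator ?E z" for z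
  proof (rule antisym)
    show "(SUP n. G n z) \<le> ennreal_pow (ennreal \<bar>inverse (w z)\<bar>) ?p' * indicator ?E z"
      by (rule SUP_least) (auto simp: G_def g_def ennreal_pow_ennreal indicator_def)
    obtain n where "g z \<le> real n" using real_arch_simple by blast
    then have "ennreal_pow (ennreal \<bar>inverse (w z)\<bar>) ?p' * indicator ?E z \<le> G n z"
      by (auto simp: G_def g_def ennreal_pow_ennreal indicator_def)
    then show "ennreal_pow (ennreal \<bar>inverse (w z)\<bar>) ?p' * indicator ?E z \<le> (SUP n. G n z)"
      by (rule order_trans) (rule SUP_upper, simp)
  qed
  have "ennreal_pow Y ?p' * (\<integral>\<^sup>+z\<in>?E. ennreal_pow (ennreal \<bar>inverse (w z)\<bar>) ?p' \<partial>lebesgue) = ennreal_pow Y ?p' * (SUP n. X n)"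
    unfolding sup[symmetric] X_def by (subst nn_integral_monotone_convergence_SUP[OF mono]) auto
  also have "\<dots> = (SUP n. ennreal_pow Y ?p' * X n)" by (rule SUP_mult_left_ennreal)
  also have "\<dots> \<le> ennreal_pow (ennreal c) ?p'"
  proof (rule SUP_least)
    fix n
    show "ennreal_pow Y ?p' * X n \<le> ennreal_pow (ennreal c) ?p'"
      using ennreal_pow_mono[OF less_imp_le[OF p'(1)] test[of n]] p'(1)
      by (simp add: ennreal_pow_mult ennreal_pow_pow)
  qed
  finally have "ennreal_pow (Y * Lp_norm ?E ?p' (\<lambda>z. ennreal \<bar>inverse (w z)\<bar>)) ?p' \<le> ennreal_pow (ennreal c) ?p'"
    using p'(1) by (simp add: ennreal_pow_mult ennreal_pow_pow Lp_norm_def)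
  then show ?thesis
    using p'(1) by (subst (asm) ennreal_pow_inverse_le_iff) (auto simp: ennreal_pow_pow Y_def a_def b_def)
qed

section \<open>The characterisation\<close>

theorem theorem4p3:
  fixes p :: real
    and q v w :: "real \<times> real \<Rightarrow> real"
    and \<alpha> \<beta> w1 w2 :: "real \<Rightarrow> real"
  assumes "q \<in> borel_measurable lebesgue"
    and "1 < p" and "ereal p < (INF z. ereal (q z))" and "(SUP z. ereal (q z)) < \<infinity>"
    and "\<alpha> \<in> borel_measurable lebesgue"
    and "0 < (INF x. ereal (\<alpha> x))" and "(SUP x. ereal (\<alpha> x)) < 1"
    and "\<beta> \<in> borel_measurable lebesgue"
    and "0 < (INF x. ereal (\<beta> x))" and "(SUP x. ereal (\<beta> x)) < 1"
    and "is_weight v" and "is_weight w" and "is_weight w1" and "is_weight w2"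
    and "\<And>x y. w (x, y) = w1 x * w2 y"
    and "dyadic_reverse_doubling (\<lambda>x. w1 x powr (- conj_exponent p))"
    and "dyadic_reverse_doubling (\<lambda>x. w2 x powr (- conj_exponent p))"
  shows "strong_frac_max_bounded p w q v \<alpha> \<beta> \<longleftrightarrow>
    (SUP I \<in> bounded_intervals. SUP J \<in> bounded_intervals.
      ennreal (inverse (measure lebesgue I * measure lebesgue J))
        * lux_norm (I \<times> J) q
            (\<lambda>(s, t). ennreal \<bar>v (s, t) * measure lebesgue I powr \<alpha> s
                                 * measure lebesgue J powr \<beta> t\<bar>)
        * Lp_norm (I \<times> J) (conj_exponent p) (\<lambda>z. ennreal \<bar>inverse (w z)\<bar>)) < \<infinity>"
    (is "_ \<longleftrightarrow> (SUP I \<in> _. SUP J \<in> _. ?test I J) < \<infinity>")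
proof -
  note q = assms(1) and p = assms(2) and \<alpha> = assms(5) and \<beta> = assms(8)
  have v: "v \<in> borel_measurable lebesgue" and w: "w \<in> borel_measurable lebesgue"
    using assms(11,12) by (auto simp: is_weight_def)
  have bounds: "0 < g x \<and> g x < 1"
    if "0 < (INF x. ereal (g x))" "(SUP x. ereal (g x)) < 1" for g :: "real \<Rightarrow> real" and x
    using less_le_trans[OF that(1) INF_lower[of x]] le_less_trans[OF SUP_upper[of x] that(2)] by simp
  have \<alpha>': "0 < \<alpha> x" "\<alpha> x < 1" and \<beta>': "0 < \<beta> x" "\<beta> x < 1" for x
    using bounds[OF assms(6,7), of x] bounds[OF assms(9,10), of x] by auto
  \<comment> \<open>a constant exponent strictly between \<open>p\<close> and the values of \<open>q\<close>\<close>
  obtain r where r: "p < r" "\<And>z. r \<le> q z"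
  proof -
    obtain r where "ereal p < ereal r" "ereal r < (INF z. ereal (q z))"
      using ereal_dense2[OF assms(3)] by auto
    then have "p < r" "r \<le> q z" for z
      using less_le_trans[of "ereal r" _ "ereal (q z)"] INF_lower[of z UNIV "\<lambda>z. ereal (q z)"]
      by (auto intro: less_imp_le)
    then show ?thesis using that by blast
  qed
  have q1: "1 \<le> q z" "0 \<le> q z" for z using r(1) r(2)[of z] p by linarith+
  show ?thesis
  proof
    assume "strong_frac_max_bounded p w q v \<alpha> \<beta>"
    then obtain c where c: "0 < c" "\<And>f. f \<in> weighted_Lp p w \<Longrightarrow>
      lux_norm UNIV q (\<lambda>z. strong_frac_max \<alpha> \<beta> f z * ennreal \<bar>v z\<bar>) \<le> ennreal c * Lp_norm UNIV p (\<lambda>z. ennreal \<bar>f z * w z\<bar>)"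
      unfolding strong_frac_max_bounded_def by blast
    have "(SUP I \<in> bounded_intervals. SUP J \<in> bounded_intervals. ?test I J) \<le> ennreal c"
      by (intro SUP_least weighted_test_condition[OF p w q1(2) c])
    then show "(SUP I \<in> bounded_intervals. SUP J \<in> bounded_intervals. ?test I J) < \<infinity>"
      by (rule le_less_trans) simp
  next
    assume sup: "(SUP I \<in> bounded_intervals. SUP J \<in> bounded_intervals. ?test I J) < \<infinity>"
    \<comment> \<open>the added \<open>1\<close> makes the bound strict\<close>
    define A where "A = enn2real (SUP I \<in> bounded_intervals. SUP J \<in> bounded_intervals. ?test I J) + 1"
    have A: "0 < A" by (simp add: A_def add_nonneg_pos)
    have test: "?test I J < ennreal A" if "I \<in> bounded_intervals" "J \<in> bounded_intervals" for I J
    proof -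
      have "?test I J \<le> (SUP I \<in> bounded_intervals. SUP J \<in> bounded_intervals. ?test I J)"
        by (rule SUP_upper2[OF that(1)], rule SUP_upper[OF that(2)])
      also have "\<dots> = ennreal (A - 1)" using sup by (simp add: A_def)
      also have "\<dots> < ennreal A" using A by (simp add: A_def ennreal_less_iff)
      finally show ?thesis .
    qed
    obtain u1 where u1: "u1 \<in> borel_measurable borel" "\<And>x. 0 < u1 x" "AE x in lborel. w1 x = u1 x"
      using weight_borel_representative[OF assms(13)] by blast
    obtain u2 where u2: "u2 \<in> borel_measurable borel" "\<And>x. 0 < u2 x" "AE x in lborel. w2 x = u2 x"
      using weight_borel_representative[OF assms(14)] by blast
    interpret product_weight p w u1 u2
    proof
      have "AE z in lborel \<Otimes>\<^sub>M lborel. w1 (fst z) = u1 (fst z) \<and> w2 (snd z) = u2 (snd z)"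
        by (rule AE_lborel_prod_fst_snd[OF u1(3) u2(3)])
      then show "AE z in lborel. w z = u1 (fst z) * u2 (snd z)"
        unfolding lborel_prod by eventually_elim (metis assms(15) prod.collapse)
    qed (fact p u1 u2)+
    have hyp: "lux_norm (dyad3 k j \<times> dyad3 l m) q
        (\<lambda>(s, t). ennreal \<bar>v (s, t) * (3 * 2 powi k) powr \<alpha> s * (3 * 2 powi l) powr \<beta> t\<bar>)
      * ennreal_pow (dual_mass p u1 (dyad3 k j) * dual_mass p u2 (dyad3 l m)) (1 / conj_exponent p)
      < ennreal (A * (9 * 2 powi k * 2 powi l))" (is "?Z < _") for k j l m
    proof -
      let ?s = "9 * 2 powi k * 2 powi l :: real"
      have "ennreal (inverse ?s) * ?Z < ennreal A"
        using test[OF dyad3_bounded_interval dyad3_bounded_interval, of k j l m]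
        unfolding measure_dyad3 Lp_norm_inverse_weight[OF measurable_dyad3 measurable_dyad3]
        by (simp add: mult.assoc)
      then have less: "ennreal ?s * (ennreal (inverse ?s) * ?Z) < ennreal ?s * ennreal A"
        by (rule ennreal_mult_strict_left_mono) auto
      have "ennreal ?s * ennreal (inverse ?s) = ennreal (?s * inverse ?s)"
        by (rule ennreal_mult[symmetric]) auto
      also have "?s * inverse ?s = 1" by (rule right_inverse) simp
      finally have "ennreal ?s * (ennreal (inverse ?s) * z) = z" for z
        by (metis ennreal_1 mult.assoc mult_1)
      moreover have "ennreal ?s * ennreal A = ennreal (?s * A)"
        by (rule ennreal_mult[symmetric]) (use A in auto)
      ultimately show ?thesis using less by (simp only: mult.commute[of A])
    qed
    have fin: "dual_mass p u1 (dyad k j) < \<infinity>" "dual_mass p u2 (dyad k j) < \<infinity>" for k j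
      using dual_mass_finite[OF assms(11) q q1(1) \<alpha>' \<beta>' less_trans[OF hyp]] by auto
    have pos: "0 < dual_mass p u1 (dyad k j)" "0 < dual_mass p u2 (dyad k j)" for k j
      by (intro dual_mass_pos measurable_dyad emeasure_dyad_nonzero u1 u2)+
    obtain b1 where b1: "1 < b1"
      "\<And>k j. ennreal b1 * dual_mass p u1 (dyad (k - 1) (2 * j)) \<le> dual_mass p u1 (dyad k j)"
      "\<And>k j. ennreal b1 * dual_mass p u1 (dyad (k - 1) (2 * j + 1)) \<le> dual_mass p u1 (dyad k j)"
      using dual_mass_reverse_doubling[OF assms(16) u1(3)] by blast
    obtain b2 where b2: "1 < b2"
      "\<And>k j. ennreal b2 * dual_mass p u2 (dyad (k - 1) (2 * j)) \<le> dual_mass p u2 (dyad k j)"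
      "\<And>k j. ennreal b2 * dual_mass p u2 (dyad (k - 1) (2 * j + 1)) \<le> dual_mass p u2 (dyad k j)"
      using dual_mass_reverse_doubling[OF assms(17) u2(3)] by blast
    have rp: "1 < r / p" using r(1) p by simp
    show "strong_frac_max_bounded p w q v \<alpha> \<beta>"
    proof (rule strong_dyadic_embedding[OF p rp b1(1) b2(1) u1(1) u2(1) u1(2) u2(2) fin pos b1(2,3) b2(2,3)])
      fix K :: real
      assume K: "0 < K" and emb: "\<And>H T.
        \<lbrakk>H \<in> borel_measurable (lborel \<Otimes>\<^sub>M lborel); 0 \<le> T; (\<integral>\<^sup>+x. \<integral>\<^sup>+y. ennreal_pow (H (x, y)) p \<partial>lborel \<partial>lborel) \<le> ennreal T\<rbrakk> \<Longrightarrow>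
        (\<integral>\<^sup>+(l, m). \<integral>\<^sup>+(k, j). ennreal_pow (ennreal_pow (\<integral>\<^sup>+x\<in>dyad k j. (\<integral>\<^sup>+y\<in>dyad l m. H (x, y) * ennreal (1 / u2 y) \<partial>lborel) * ennreal (1 / u1 x) \<partial>lborel) p
            * ennreal ((enn2real (dual_mass p u1 (dyad k j)) * enn2real (dual_mass p u2 (dyad l m))) powr (1 - p))) (r / p)
          \<partial>count_space UNIV \<partial>count_space UNIV) \<le> ennreal (K * T powr (r / p))"
      define c where "c = 324 * A * (1 + K)"
      have c: "0 < c" using A K by (simp add: c_def)
      have "lux_norm UNIV q (\<lambda>z. strong_frac_max \<alpha> \<beta> f z * ennreal \<bar>v z\<bar>)
          \<le> ennreal c * Lp_norm UNIV p (\<lambda>z. ennreal \<bar>f z * w z\<bar>)" if f: "f \<in> weighted_Lp p w" for f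
      proof (rule ennreal_le_epsilon)
        fix e :: real assume e: "0 < e"
        obtain N where N: "Lp_norm UNIV p (\<lambda>z. ennreal \<bar>f z * w z\<bar>) = ennreal N" "0 \<le> N"
          using f by (cases "Lp_norm UNIV p (\<lambda>z. ennreal \<bar>f z * w z\<bar>)") (auto simp: weighted_Lp_def)
        \<comment> \<open>\<open>T\<close> has to be positive also when the norm \<open>N\<close> of \<open>f w\<close> is \<open>0\<close>\<close>
        define T where "T = N + e / c"
        have T: "0 < T" "N \<le> T" using N e c by (auto simp: T_def add_nonneg_pos)
        have "(\<integral>\<^sup>+z. ennreal_pow (ennreal \<bar>f z * w z\<bar>) p \<partial>lebesgue) = ennreal_pow (ennreal N) p"
          unfolding N(1)[symmetric] Lp_norm_def using p by (simp add: ennreal_pow_pow)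
        also have "\<dots> \<le> ennreal (T powr p)"
          using N T p by (simp add: ennreal_pow_ennreal ennreal_leI powr_mono2)
        finally have Tp: "(\<integral>\<^sup>+z. ennreal_pow (ennreal \<bar>f z * w z\<bar>) p \<partial>lebesgue) \<le> ennreal (T powr p)" .
        have "lux_norm UNIV q (\<lambda>z. strong_frac_max \<alpha> \<beta> f z * ennreal \<bar>v z\<bar>) \<le> ennreal (c * T)"
          unfolding c_def
          by (rule strong_frac_max_norm_bound[OF K emb r q \<alpha> \<alpha>' \<beta> \<beta>' v fin pos A hyp _ w T(1) Tp])
             (use f in \<open>auto simp: weighted_Lp_def\<close>)
        also have "ennreal (c * T) = ennreal c * ennreal N + ennreal e"
          using c N e by (simp add: T_def distrib_left ennreal_mult)
        finally show "lux_norm UNIV q (\<lambda>z. strong_frac_max \<alpha> \<beta> f z * ennreal \<bar>v z\<bar>)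
          \<le> ennreal c * Lp_norm UNIV p (\<lambda>z. ennreal \<bar>f z * w z\<bar>) + ennreal e"
          unfolding N(1) .
      qed
      then show "strong_frac_max_bounded p w q v \<alpha> \<beta>"
        unfolding strong_frac_max_bounded_def using c by blast
    qed
  qed
qed

end
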